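(* Let $D=\mathbb T^2$. Let $\rho_0$ be a smooth density on $D$ with $\int_D\rho_0\,dx=1$ and $0<C_1^{-1}\le\rho_0\le C_1<\infty$ for some $C_1>1$, and let $u_0$ be a smooth divergence-free vector field with $\int_D\rho_0u_0\,dx=0$. Let $(u,\rho,p)$ be a smooth solution, with initial data $(u_0,\rho_0)$, of the inhomogeneous incompressible Euler system $$\partial_t(\rho u)+\nabla\cdot(\rho u\otimes u)+\nabla p=0,\qquad \nabla\cdot u=0,\qquad \partial_t\rho+u\cdot\nabla\rho=0 .$$ Then, with $\omega=\nabla\times(\rho u)$, the following stream-vorticity formulation holds: $$\partial_t\omega+u\cdot\nabla\omega+\Big\{\tfrac12|u|^2,\rho\Big\}=0,\qquad u=\mathbf P_\rho\big(\rho^{-1}\nabla^\perp\Delta^{-1}\omega\big),\qquad \partial_t\rho+u\cdot\nabla\rho=0 .$$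
   Context: In two dimensions: $\nabla^\perp\psi=(-\partial_2\psi,\partial_1\psi)$, $\nabla\times v=\partial_1v_2-\partial_2v_1$, and $\{f,g\}=\partial_1f\,\partial_2g-\partial_2f\,\partial_1g$ is the standard Poisson bracket. $\Delta^{-1}$ is the inverse Laplacian on mean-zero functions on $\mathbb T^2$. For a smooth density $\rho$ bounded above and away from zero, $\Delta_\rho\varphi=\nabla\cdot(\rho^{-1}\nabla\varphi)$, $\Delta_\rho^{-1}$ is its inverse on mean-zero functions, and $\mathbf P_\rho w=w-\rho^{-1}\nabla\Delta_\rho^{-1}\nabla\cdot w$ is the weighted Leray projector. *)

theory Defs
  imports "HOL-Analysis.Analysis"
begin

text \<open>
  The torus is the quotient of the plane by the integer lattice. Functions on it are represented
  by functions on the plane that have period 1 in each coordinate; integrals over the torus are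
  integrals over the unit square.
\<close>

definition periodic :: "(real^2 \<Rightarrow> 'b) \<Rightarrow> bool" where
  "periodic f \<longleftrightarrow> (\<forall>x i. f (x + axis i 1) = f x)"

definition torus_integral :: "(real^2 \<Rightarrow> 'b::euclidean_space) \<Rightarrow> 'b" where
  "torus_integral f = integral (cbox 0 1) f"

text \<open>
  Derivatives are taken within the set. The definitions are only used for the whole plane and for
  \<open>I \<times> UNIV\<close> with \<open>I\<close> a nondegenerate interval; derivatives within these sets are
  unique, and at an endpoint of \<open>I\<close> they are one-sided in time.
\<close>

primrec Ck_on :: "nat \<Rightarrow> 'a::real_normed_vector set \<Rightarrow> ('a \<Rightarrow> 'b::real_normed_vector) \<Rightarrow> bool" where
  "Ck_on 0 S f \<longleftrightarrow> continuous_on S f"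
| "Ck_on (Suc k) S f \<longleftrightarrow>
     f differentiable_on S \<and> (\<forall>v. Ck_on k S (\<lambda>x. frechet_derivative f (at x within S) v))"

definition smooth_on :: "'a::real_normed_vector set \<Rightarrow> ('a \<Rightarrow> 'b::real_normed_vector) \<Rightarrow> bool" where
  "smooth_on S f \<longleftrightarrow> (\<forall>k. Ck_on k S f)"

definition torus_smooth :: "(real^2 \<Rightarrow> 'b::real_normed_vector) \<Rightarrow> bool" where
  "torus_smooth f \<longleftrightarrow> periodic f \<and> smooth_on UNIV f"

definition torus_smooth_time :: "real set \<Rightarrow> (real \<Rightarrow> real^2 \<Rightarrow> 'b::real_normed_vector) \<Rightarrow> bool" where
  "torus_smooth_time I f \<longleftrightarrow>
     (\<forall>t\<in>I. periodic (f t)) \<and> smooth_on (I \<times> UNIV) (\<lambda>(t, x). f t x)"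

definition partial_deriv :: "2 \<Rightarrow> (real^2 \<Rightarrow> real) \<Rightarrow> real^2 \<Rightarrow> real" where
  "partial_deriv i f x = deriv (\<lambda>h. f (x + h *\<^sub>R axis i 1)) 0"

definition time_deriv ::
    "real set \<Rightarrow> (real \<Rightarrow> real^2 \<Rightarrow> 'b::real_normed_vector) \<Rightarrow> real \<Rightarrow> real^2 \<Rightarrow> 'b" where
  "time_deriv I f t x = vector_derivative (\<lambda>s. f s x) (at t within I)"

definition grad :: "(real^2 \<Rightarrow> real) \<Rightarrow> real^2 \<Rightarrow> real^2" where
  "grad f x = (\<chi> i. partial_deriv i f x)"

definition perp_grad :: "(real^2 \<Rightarrow> real) \<Rightarrow> real^2 \<Rightarrow> real^2" where
  "perp_grad f x = vector [- partial_deriv 2 f x, partial_deriv 1 f x]"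

definition divergence :: "(real^2 \<Rightarrow> real^2) \<Rightarrow> real^2 \<Rightarrow> real" where
  "divergence v x = (\<Sum>i\<in>UNIV. partial_deriv i (\<lambda>y. v y $ i) x)"

definition curl :: "(real^2 \<Rightarrow> real^2) \<Rightarrow> real^2 \<Rightarrow> real" where
  "curl v x = partial_deriv 1 (\<lambda>y. v y $ 2) x - partial_deriv 2 (\<lambda>y. v y $ 1) x"

definition poisson_bracket :: "(real^2 \<Rightarrow> real) \<Rightarrow> (real^2 \<Rightarrow> real) \<Rightarrow> real^2 \<Rightarrow> real" where
  "poisson_bracket f g x =
     partial_deriv 1 f x * partial_deriv 2 g x - partial_deriv 2 f x * partial_deriv 1 g x"

definition outer :: "real^2 \<Rightarrow> real^2 \<Rightarrow> real^2^2" where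
  "outer v w = (\<chi> i j. v $ i * w $ j)"

definition tensor_divergence :: "(real^2 \<Rightarrow> real^2^2) \<Rightarrow> real^2 \<Rightarrow> real^2" where
  "tensor_divergence M x = (\<chi> i. \<Sum>j\<in>UNIV. partial_deriv j (\<lambda>y. M y $ i $ j) x)"

text \<open>
  The inverses below are meaningful on the image of \<open>mean_zero\<close> only; elsewhere
  \<open>the_inv_into\<close> returns an unspecified function.
\<close>

definition mean_zero :: "(real^2 \<Rightarrow> real) set" where
  "mean_zero = {\<phi>. torus_smooth \<phi> \<and> torus_integral \<phi> = 0}"

definition laplacian :: "(real^2 \<Rightarrow> real) \<Rightarrow> real^2 \<Rightarrow> real" where
  "laplacian \<phi> = divergence (grad \<phi>)"

definition inv_laplacian :: "(real^2 \<Rightarrow> real) \<Rightarrow> real^2 \<Rightarrow> real" where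
  "inv_laplacian = the_inv_into mean_zero laplacian"

definition weighted_laplacian :: "(real^2 \<Rightarrow> real) \<Rightarrow> (real^2 \<Rightarrow> real) \<Rightarrow> real^2 \<Rightarrow> real" where
  "weighted_laplacian \<rho> \<phi> = divergence (\<lambda>x. inverse (\<rho> x) *\<^sub>R grad \<phi> x)"

definition inv_weighted_laplacian :: "(real^2 \<Rightarrow> real) \<Rightarrow> (real^2 \<Rightarrow> real) \<Rightarrow> real^2 \<Rightarrow> real" where
  "inv_weighted_laplacian \<rho> = the_inv_into mean_zero (weighted_laplacian \<rho>)"

definition weighted_leray :: "(real^2 \<Rightarrow> real) \<Rightarrow> (real^2 \<Rightarrow> real^2) \<Rightarrow> real^2 \<Rightarrow> real^2" where
  "weighted_leray \<rho> w x =
     w x - inverse (\<rho> x) *\<^sub>R grad (inv_weighted_laplacian \<rho> (divergence w)) x"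

definition inhomogeneous_euler ::
    "real set \<Rightarrow> (real \<Rightarrow> real^2 \<Rightarrow> real^2) \<Rightarrow> (real \<Rightarrow> real^2 \<Rightarrow> real) \<Rightarrow> (real \<Rightarrow> real^2 \<Rightarrow> real) \<Rightarrow> bool" where
  "inhomogeneous_euler I u \<rho> p \<longleftrightarrow>
     (\<forall>t\<in>I. \<forall>x.
        time_deriv I (\<lambda>t x. \<rho> t x *\<^sub>R u t x) t x
          + tensor_divergence (\<lambda>y. \<rho> t y *\<^sub>R outer (u t y) (u t y)) x
          + grad (p t) x = 0
      \<and> divergence (u t) x = 0
      \<and> time_deriv I \<rho> t x + u t x \<bullet> grad (\<rho> t) x = 0)"

end

(*
  With m = rho u, the curl of the momentum equation removes the pressure, and div u = 0 turns
  the convective term into u . grad omega + {|u|^2/2, rho}.  For the velocity, let psi and q be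
  the periodic solutions of Laplace psi = curl m and Laplace q = div m (both right-hand sides have
  mean zero).  The remainder m - perp_grad psi - grad q has zero curl and divergence and zero mean
  (momentum is conserved), so its components are harmonic with mean zero and vanish.  Dividing by
  rho gives u = w + grad q / rho with w = perp_grad psi / rho, and div u = 0 says that -q is the
  solution of the weighted Poisson equation that defines the projector at w.  Only the
  constant-coefficient Poisson equation has to be solved, which Fourier series do; for the weighted
  Laplacian uniqueness, an energy identity, is enough.
*)

theory Submission
  imports Defs
begin

text \<open>Both inverse Laplacians invert maps on \<open>mean_zero\<close>, so they are specified
  only at values attained by some smooth periodic function of mean zero. Evaluating one of them
  takes a preimage together with injectivity, and smoothness of the preimage is part of the task:
  for the Laplacian it comes from rapid decrease of Fourier coefficients, and the preimage under the
  weighted Laplacian inherits it from q.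

  The weighted operators at time t ask for a positive density at time t, whereas the bounds on the
  density are given at time 0. A lower bound therefore has to be carried along by the transport
  equation.

  The time interval may contain endpoints, where time derivatives are one-sided. This shapes the
  calculus: derivatives within \<open>I \<times> UNIV\<close> have to be shown unique, and time and
  space derivatives have to be exchanged at points that have no open neighbourhood in the
  domain.\<close>

section \<open>Calculus of smooth functions\<close>

text \<open>Derivatives within such a set are unique, so that \<^const>\<open>frechet_derivative\<close>, a choice,
  returns the expected one.\<close>

definition thick :: "'a::euclidean_space set \<Rightarrow> bool" where
  "thick S \<longleftrightarrow> (\<forall>x\<in>S. \<forall>i\<in>Basis. \<forall>e>0. \<exists>d. 0 < \<bar>d\<bar> \<and> \<bar>d\<bar> < e \<and> x + d *\<^sub>R i \<in> S)"

lemma thick_UNIV [simp]: "thick UNIV"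
  unfolding thick_def
proof (intro ballI allI impI)
  fix x i :: 'a and e :: real
  assume "e > 0"
  then show "\<exists>d. 0 < \<bar>d\<bar> \<and> \<bar>d\<bar> < e \<and> x + d *\<^sub>R i \<in> UNIV"
    by (intro exI[of _ "e/2"]) auto
qed

lemma interval_accumulates:
  fixes J :: "real set"
  assumes "is_interval J" "t0 \<in> J" "J \<noteq> {t0}" "t \<in> J" "e > 0"
  shows "\<exists>d. 0 < \<bar>d\<bar> \<and> \<bar>d\<bar> < e \<and> t + d \<in> J"
proof -
  obtain s where s: "s \<in> J" "s \<noteq> t"
    using assms by blast
  have J: "y \<in> J" if "a \<in> J" "b \<in> J" "a \<le> y" "y \<le> b" for a b y
    using assms(1) that unfolding is_interval_1 by blast
  \<comment> \<open>The bound by the distance to s keeps t + m or t - m between t and s, hence in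
    J.\<close>
  define m where "m = min (e/2) \<bar>s - t\<bar>"
  have m: "m > 0" "m < e" "m \<le> \<bar>s - t\<bar>"
    using s \<open>e > 0\<close> unfolding m_def by auto
  show ?thesis
  proof (cases "s > t")
    case True
    then show ?thesis
      using m J[of t s "t + m"] s assms by (intro exI[of _ m]) auto
  next
    case False
    then show ?thesis
      using m J[of s t "t - m"] s assms by (intro exI[of _ "-m"]) auto
  qed
qed

lemma thick_time:
  fixes J :: "real set"
  assumes "is_interval J" "t0 \<in> J" "J \<noteq> {t0}"
  shows "thick (J \<times> (UNIV :: 'a::euclidean_space set))"
  unfolding thick_def
proof (intro ballI allI impI)
  fix x :: "real \<times> 'a" and i :: "real \<times> 'a" and e :: real
  assume x: "x \<in> J \<times> UNIV" and i: "i \<in> Basis" and e: "e > 0"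
  show "\<exists>d. 0 < \<bar>d\<bar> \<and> \<bar>d\<bar> < e \<and> x + d *\<^sub>R i \<in> J \<times> UNIV"
  proof (cases "fst i = 0")
    case True
    then show ?thesis
      using x e by (intro exI[of _ "e/2"]) (auto simp: mem_Times_iff)
  next
    \<comment> \<open>A basis vector with a time component is the pure time direction, so the small
      step has to stay inside J.\<close>
    case False
    then have "fst i = 1"
      using i by (auto simp: Basis_prod_def)
    with interval_accumulates[OF assms, of "fst x" e] x e show ?thesis
      by (auto simp: mem_Times_iff)
  qed
qed

lemma frechet_derivative_within:
  fixes f :: "'a::euclidean_space \<Rightarrow> 'b::real_normed_vector"
  assumes "thick S" "x \<in> S" "(f has_derivative f') (at x within S)"
  shows "frechet_derivative f (at x within S) = f'"
proof -
  have "(f has_derivative frechet_derivative f (at x within S)) (at x within S)"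
    using assms(3) frechet_derivative_works differentiable_def by blast
  then show ?thesis
    using assms unfolding thick_def
    by (intro frechet_derivative_unique_within[where S=S and x=x and f=f]) auto
qed

text \<open>Both sides are the same choice from the same set of candidates, so uniqueness of
  derivatives does not enter.\<close>

lemma frechet_derivative_cong:
  assumes "x \<in> S" "\<And>y. y \<in> S \<Longrightarrow> f y = g y"
  shows "frechet_derivative f (at x within S) = frechet_derivative g (at x within S)"
proof -
  have "(f has_derivative f') (at x within S) \<longleftrightarrow> (g has_derivative f') (at x within S)" for f'
    using assms by (metis has_derivative_transform)
  then show ?thesis
    unfolding frechet_derivative_def by simp
qed

lemma Ck_on_cong:
  assumes "\<And>x. x \<in> S \<Longrightarrow> f x = g x" "Ck_on k S f"
  shows "Ck_on k S g"
  using assms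
proof (induction k arbitrary: f g)
  case 0
  then show ?case using continuous_on_cong by (metis Ck_on.simps(1))
next
  case (Suc k)
  have "g differentiable_on S"
    unfolding differentiable_on_def
  proof
    fix x assume "x \<in> S"
    then have "(f has_derivative frechet_derivative f (at x within S)) (at x within S)"
      using Suc.prems(2) by (intro frechet_derivative_works[THEN iffD1]) (simp add: differentiable_on_def)
    then have "(g has_derivative frechet_derivative f (at x within S)) (at x within S)"
      by (rule has_derivative_transform[OF \<open>x \<in> S\<close>, rotated]) (rule Suc.prems(1)[symmetric])
    then show "g differentiable (at x within S)"
      unfolding differentiable_def by blast
  qed
  moreover have "Ck_on k S (\<lambda>x. frechet_derivative g (at x within S) v)" for v
  proof (rule Suc.IH)
    show "frechet_derivative f (at x within S) v = frechet_derivative g (at x within S) v" if "x \<in> S" for x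
      using frechet_derivative_cong[of x S f g] that Suc.prems by simp
    show "Ck_on k S (\<lambda>x. frechet_derivative f (at x within S) v)"
      using Suc.prems by simp
  qed
  ultimately show ?case by simp
qed

text \<open>Thickness forces the chosen derivative to be the explicit \<open>f'\<close>, so the
  recursion in \<open>Ck_on\<close> can be run on derivative formulas.\<close>

lemma Ck_on_SucI:
  fixes f :: "'a::euclidean_space \<Rightarrow> 'b::real_normed_vector"
  assumes "thick S" "\<And>x. x \<in> S \<Longrightarrow> (f has_derivative f' x) (at x within S)"
    and "\<And>v. Ck_on k S (\<lambda>x. f' x v)"
  shows "Ck_on (Suc k) S f"
proof -
  have "Ck_on k S (\<lambda>x. frechet_derivative f (at x within S) v)" for v
    using assms(3)[of v]
    by (rule Ck_on_cong[rotated]) (simp add: frechet_derivative_within[OF assms(1) _ assms(2)])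
  then show ?thesis
    using assms(2) by (auto simp: differentiable_on_def differentiable_def)
qed

lemma Ck_on_SucD:
  assumes "Ck_on (Suc k) S f"
  shows "x \<in> S \<Longrightarrow> (f has_derivative frechet_derivative f (at x within S)) (at x within S)"
    and "Ck_on k S (\<lambda>x. frechet_derivative f (at x within S) v)"
  using assms frechet_derivative_works by (auto simp: differentiable_on_def)

lemma Ck_on_Suc_imp: "Ck_on (Suc k) S f \<Longrightarrow> Ck_on k S f"
proof (induction k arbitrary: f)
  case 0
  then show ?case by (simp add: differentiable_imp_continuous_on)
next
  case (Suc k)
  then show ?case by (metis Ck_on.simps(2))
qed

section \<open>Closure of k-fold differentiability under algebra and affine substitution\<close>

lemma Ck_on_const:
  fixes c :: "'b::real_normed_vector"
  assumes "thick S"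
  shows "Ck_on k S (\<lambda>x. c)"
proof (induction k arbitrary: c)
  case (Suc k)
  show ?case
    by (rule Ck_on_SucI[OF assms, where f' = "\<lambda>_ _. 0"]) (auto intro: Suc)
qed simp

lemma Ck_on_bounded_linear:
  assumes "thick S" "bounded_linear L" "Ck_on k S f"
  shows "Ck_on k S (\<lambda>x. L (f x))"
  using assms(3)
proof (induction k arbitrary: f)
  case 0
  then show ?case
    using assms(2) by (simp add: bounded_linear.continuous_on)
next
  case (Suc k)
  show ?case
    by (rule Ck_on_SucI[OF assms(1)])
       (use Suc.IH[OF Ck_on_SucD(2)[OF Suc.prems]] Ck_on_SucD(1)[OF Suc.prems]
          in \<open>auto intro!: bounded_linear.has_derivative[OF assms(2)]\<close>)
qed

lemma Ck_on_add:
  assumes "thick S" "Ck_on k S f" "Ck_on k S g"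
  shows "Ck_on k S (\<lambda>x. f x + g x)"
  using assms(2,3)
proof (induction k arbitrary: f g)
  case 0
  then show ?case by (simp add: continuous_on_add)
next
  case (Suc k)
  note D = Ck_on_SucD[OF Suc.prems(1)] Ck_on_SucD[OF Suc.prems(2)]
  show ?case
    by (rule Ck_on_SucI[OF assms(1) has_derivative_add[OF D(1,3)] Suc.IH[OF D(2,4)]])
qed

text \<open>The product rule leaves each factor once undifferentiated; there
  \<open>Ck_on_Suc_imp\<close> lowers the order so that the induction hypothesis applies.\<close>

lemma Ck_on_mult:
  fixes f g :: "'a::euclidean_space \<Rightarrow> 'b::real_normed_algebra"
  assumes "thick S" "Ck_on k S f" "Ck_on k S g"
  shows "Ck_on k S (\<lambda>x. f x * g x)"
  using assms(2,3)
proof (induction k arbitrary: f g)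
  case 0
  then show ?case by (simp add: continuous_on_mult)
next
  case (Suc k)
  note D = Ck_on_SucD[OF Suc.prems(1)] Ck_on_SucD[OF Suc.prems(2)]
  show ?case
    by (rule Ck_on_SucI[OF assms(1) has_derivative_mult[OF D(1,3)]])
       (auto intro!: Ck_on_add[OF assms(1)] Suc.IH D(2,4) intro: Ck_on_Suc_imp Suc.prems)
qed

text \<open>The derivative of 1/f is a product of 1/f, f' and 1/f. Hence f stays fixed in the
  induction: the hypothesis at order k already covers the two factors 1/f.\<close>

lemma Ck_on_inverse:
  fixes f :: "'a::euclidean_space \<Rightarrow> real"
  assumes "thick S" "\<And>x. x \<in> S \<Longrightarrow> f x \<noteq> 0" "Ck_on k S f"
  shows "Ck_on k S (\<lambda>x. inverse (f x))"
  using assms(3)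
proof (induction k)
  case 0
  then show ?case using assms(2) by (simp add: continuous_on_inverse)
next
  case (Suc k)
  note D = Ck_on_SucD[OF Suc.prems]
  note inv = Suc.IH[OF Ck_on_Suc_imp[OF Suc.prems]]
  show ?case
  proof (rule Ck_on_SucI[OF assms(1)])
    show "((\<lambda>x. inverse (f x)) has_derivative
        (\<lambda>v. - (inverse (f x) * frechet_derivative f (at x within S) v * inverse (f x))))
        (at x within S)" if "x \<in> S" for x
      by (rule Deriv.has_derivative_inverse[OF assms(2)[OF that] D(1)[OF that]])
    show "Ck_on k S
        (\<lambda>x. - (inverse (f x) * frechet_derivative f (at x within S) v * inverse (f x)))" for v
      by (intro Ck_on_bounded_linear[OF assms(1) bounded_linear_minus[OF bounded_linear_ident]]
            Ck_on_mult assms(1) inv D(2))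
  qed
qed

text \<open>An affine map has constant derivative, so differentiating the composite gives a
  composite with the same map and the induction closes without a higher-order chain rule. Time
  slices and translations along an axis are of this form.\<close>

lemma Ck_on_affine:
  fixes f :: "'a::euclidean_space \<Rightarrow> 'b::real_normed_vector" and L :: "'c::euclidean_space \<Rightarrow> 'a"
  assumes "thick T" "bounded_linear L" "\<And>x. x \<in> T \<Longrightarrow> a + L x \<in> S" "Ck_on k S f"
  shows "Ck_on k T (\<lambda>x. f (a + L x))"
  using assms(4)
proof (induction k arbitrary: f)
  case 0
  then have f: "continuous_on S f" by simp
  have g: "continuous_on T (\<lambda>x. a + L x)"
    by (intro continuous_intros bounded_linear.continuous_on[OF assms(2)])
  show ?case
    using continuous_on_compose2[OF f g] assms(3) by auto
next
  case (Suc k)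
  note D = Ck_on_SucD[OF Suc.prems]
  have L: "((\<lambda>x. a + L x) has_derivative L) (at x within T)" for x
    by (auto intro!: derivative_eq_intros bounded_linear_imp_has_derivative assms(2))
  have "((\<lambda>x. f (a + L x)) has_derivative (\<lambda>v. frechet_derivative f (at (a + L x) within S) (L v)))
      (at x within T)" if "x \<in> T" for x
  proof -
    have "(f has_derivative frechet_derivative f (at (a + L x) within S))
        (at (a + L x) within (\<lambda>x. a + L x) ` T)"
      by (rule has_derivative_subset[OF D(1)]) (use assms(3) that in auto)
    then show ?thesis
      using has_derivative_in_compose[OF L] by fastforce
  qed
  moreover have "Ck_on k T (\<lambda>x. frechet_derivative f (at (a + L x) within S) (L v))" for v
    using Suc.IH[OF D(2)[of "L v"]] .
  ultimately show ?case
    by (rule Ck_on_SucI[OF assms(1)])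
qed

lemma smooth_on_cong: "smooth_on S f \<Longrightarrow> (\<And>x. x \<in> S \<Longrightarrow> f x = g x) \<Longrightarrow> smooth_on S g"
  unfolding smooth_on_def using Ck_on_cong by blast

lemma smooth_on_continuous: "smooth_on S f \<Longrightarrow> continuous_on S f"
  unfolding smooth_on_def by (metis Ck_on.simps(1))

lemma smooth_on_has_derivative:
  "smooth_on S f \<Longrightarrow> x \<in> S \<Longrightarrow>
    (f has_derivative frechet_derivative f (at x within S)) (at x within S)"
  unfolding smooth_on_def using Ck_on_SucD(1) by blast

lemma smooth_on_frechet_derivative:
  "smooth_on S f \<Longrightarrow> smooth_on S (\<lambda>x. frechet_derivative f (at x within S) v)"
  unfolding smooth_on_def using Ck_on_SucD(2) by blast

lemma smooth_on_const: "thick S \<Longrightarrow> smooth_on S (\<lambda>x. c)"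
  unfolding smooth_on_def using Ck_on_const by blast

lemma smooth_on_bounded_linear:
  "thick S \<Longrightarrow> bounded_linear L \<Longrightarrow> smooth_on S f \<Longrightarrow> smooth_on S (\<lambda>x. L (f x))"
  unfolding smooth_on_def using Ck_on_bounded_linear by blast

lemma smooth_on_add:
  "thick S \<Longrightarrow> smooth_on S f \<Longrightarrow> smooth_on S g \<Longrightarrow> smooth_on S (\<lambda>x. f x + g x)"
  unfolding smooth_on_def using Ck_on_add by blast

lemma smooth_on_minus: "thick S \<Longrightarrow> smooth_on S f \<Longrightarrow> smooth_on S (\<lambda>x. - f x)"
  using smooth_on_bounded_linear[OF _ bounded_linear_minus[OF bounded_linear_ident]] .

lemma smooth_on_diff:
  "thick S \<Longrightarrow> smooth_on S f \<Longrightarrow> smooth_on S g \<Longrightarrow> smooth_on S (\<lambda>x. f x - g x)"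
  using smooth_on_add[OF _ _ smooth_on_minus] by force

lemma smooth_on_mult:
  fixes f g :: "'a::euclidean_space \<Rightarrow> 'b::real_normed_algebra"
  shows "thick S \<Longrightarrow> smooth_on S f \<Longrightarrow> smooth_on S g \<Longrightarrow> smooth_on S (\<lambda>x. f x * g x)"
  unfolding smooth_on_def using Ck_on_mult by blast

lemma smooth_on_inverse:
  fixes f :: "'a::euclidean_space \<Rightarrow> real"
  shows "thick S \<Longrightarrow> (\<And>x. x \<in> S \<Longrightarrow> f x \<noteq> 0) \<Longrightarrow> smooth_on S f
    \<Longrightarrow> smooth_on S (\<lambda>x. inverse (f x))"
  unfolding smooth_on_def using Ck_on_inverse by blast

lemma smooth_on_affine:
  fixes f :: "'a::euclidean_space \<Rightarrow> 'b::real_normed_vector" and L :: "'c::euclidean_space \<Rightarrow> 'a"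
  shows "thick T \<Longrightarrow> bounded_linear L \<Longrightarrow> (\<And>x. x \<in> T \<Longrightarrow> a + L x \<in> S) \<Longrightarrow> smooth_on S f
    \<Longrightarrow> smooth_on T (\<lambda>x. f (a + L x))"
  unfolding smooth_on_def using Ck_on_affine by blast

section \<open>Partial derivatives\<close>

lemma partial_deriv_eq:
  assumes "(f has_derivative f') (at x)"
  shows "partial_deriv i f x = f' (axis i 1)"
proof -
  have g: "((\<lambda>h. x + h *\<^sub>R axis i 1) has_derivative (\<lambda>h. h *\<^sub>R axis i 1)) (at (0::real))"
    by (auto intro!: derivative_eq_intros)
  have "((\<lambda>h. f (x + h *\<^sub>R axis i 1)) has_derivative (\<lambda>h. f' (h *\<^sub>R axis i 1))) (at 0)"
    using has_derivative_compose[OF g, of f f'] assms by simp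
  moreover have "f' (h *\<^sub>R axis i 1) = f' (axis i 1) * h" for h
    using linear_cmul[OF has_derivative_linear[OF assms]] by simp
  ultimately show ?thesis
    unfolding partial_deriv_def by (simp add: DERIV_imp_deriv has_field_derivative_def)
qed

text \<open>With the differential written through \<open>grad\<close>, the rules for
  \<open>partial_deriv\<close> are read off from those for \<open>has_derivative\<close> by
  evaluating at a basis vector.\<close>

lemma has_derivative_grad:
  fixes f :: "real^2 \<Rightarrow> real"
  assumes "f differentiable (at x)"
  shows "(f has_derivative (\<lambda>v. v \<bullet> grad f x)) (at x)"
proof -
  from assms obtain f' where f': "(f has_derivative f') (at x)"
    unfolding differentiable_def by blast
  have "f' v = v \<bullet> grad f x" for v
  proof -
    have "v = v$1 *\<^sub>R axis 1 1 + v$2 *\<^sub>R axis 2 1"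
      by (simp add: vec_eq_iff forall_2 axis_def)
    then have "f' v = f' (v$1 *\<^sub>R axis 1 1 + v$2 *\<^sub>R axis 2 1)"
      by simp
    also have "\<dots> = v$1 * f' (axis 1 1) + v$2 * f' (axis 2 1)"
      using has_derivative_linear[OF f'] by (simp add: linear_add linear_cmul)
    finally have "f' v = v$1 * f' (axis 1 1) + v$2 * f' (axis 2 1)" .
    then show ?thesis
      by (simp add: inner_vec_def sum_2 grad_def partial_deriv_eq[OF f'])
  qed
  then show ?thesis using f' by presburger
qed

lemma partial_deriv_add:
  "f differentiable (at x) \<Longrightarrow> g differentiable (at x) \<Longrightarrow>
    partial_deriv i (\<lambda>y. f y + g y) x = partial_deriv i f x + partial_deriv i g x"
  by (subst partial_deriv_eq[OF has_derivative_add[OF has_derivative_grad has_derivative_grad]])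
     (auto simp: grad_def inner_axis')

lemma partial_deriv_minus:
  "f differentiable (at x) \<Longrightarrow> partial_deriv i (\<lambda>y. - f y) x = - partial_deriv i f x"
  by (subst partial_deriv_eq[OF has_derivative_minus[OF has_derivative_grad]])
     (auto simp: grad_def inner_axis')

lemma partial_deriv_diff:
  "f differentiable (at x) \<Longrightarrow> g differentiable (at x) \<Longrightarrow>
    partial_deriv i (\<lambda>y. f y - g y) x = partial_deriv i f x - partial_deriv i g x"
  by (subst partial_deriv_eq[OF has_derivative_diff[OF has_derivative_grad has_derivative_grad]])
     (auto simp: grad_def inner_axis')

lemma partial_deriv_mult:
  "f differentiable (at x) \<Longrightarrow> g differentiable (at x) \<Longrightarrow>
    partial_deriv i (\<lambda>y. f y * g y) x = f x * partial_deriv i g x + partial_deriv i f x * g x"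
  by (subst partial_deriv_eq[OF has_derivative_mult[OF has_derivative_grad has_derivative_grad]])
     (auto simp: grad_def inner_axis')

lemma partial_deriv_const [simp]: "partial_deriv i (\<lambda>y. c) x = 0"
  by (simp add: partial_deriv_def)

lemma smooth_differentiable: "smooth_on UNIV f \<Longrightarrow> f differentiable (at x)"
  using smooth_on_has_derivative[of UNIV f x] by (auto simp: differentiable_def)

lemma smooth_partial_deriv:
  assumes "smooth_on UNIV f"
  shows "smooth_on UNIV (partial_deriv i f)"
proof -
  have "partial_deriv i f x = frechet_derivative f (at x) (axis i 1)" for x
    using partial_deriv_eq[of f _ x] smooth_on_has_derivative[OF assms] by simp
  then show ?thesis
    using smooth_on_frechet_derivative[OF assms, of "axis i 1"] by (metis (no_types, lifting) ext)
qed

lemma periodic_partial_deriv: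
  assumes "periodic f"
  shows "periodic (partial_deriv i f)"
  unfolding periodic_def
proof (intro allI)
  fix x :: "real^2" and j :: 2
  have "f (x + h *\<^sub>R axis i 1 + axis j 1) = f (x + h *\<^sub>R axis i 1)" for h :: real
    using assms unfolding periodic_def by blast
  then have "f (x + axis j 1 + h *\<^sub>R axis i 1) = f (x + h *\<^sub>R axis i 1)" for h :: real
    by (simp add: algebra_simps)
  then show "partial_deriv i f (x + axis j 1) = partial_deriv i f x"
    unfolding partial_deriv_def by simp
qed

section \<open>Closure properties of smooth functions on the torus\<close>

lemma torus_smooth_partial_deriv: "torus_smooth f \<Longrightarrow> torus_smooth (partial_deriv i f)"
  by (simp add: torus_smooth_def smooth_partial_deriv periodic_partial_deriv)

lemma torus_smooth_const: "torus_smooth (\<lambda>x. c)"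
  by (simp add: torus_smooth_def smooth_on_const periodic_def)

lemma torus_smooth_add: "torus_smooth f \<Longrightarrow> torus_smooth g \<Longrightarrow> torus_smooth (\<lambda>x. f x + g x)"
  by (simp add: torus_smooth_def smooth_on_add periodic_def)

lemma torus_smooth_minus: "torus_smooth f \<Longrightarrow> torus_smooth (\<lambda>x. - f x)"
  by (simp add: torus_smooth_def smooth_on_minus periodic_def)

lemma torus_smooth_diff: "torus_smooth f \<Longrightarrow> torus_smooth g \<Longrightarrow> torus_smooth (\<lambda>x. f x - g x)"
  by (simp add: torus_smooth_def smooth_on_diff periodic_def)

lemma torus_smooth_mult:
  fixes f g :: "real^2 \<Rightarrow> real"
  shows "torus_smooth f \<Longrightarrow> torus_smooth g \<Longrightarrow> torus_smooth (\<lambda>x. f x * g x)"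
  by (simp add: torus_smooth_def smooth_on_mult periodic_def)

lemma torus_smooth_inverse:
  fixes f :: "real^2 \<Rightarrow> real"
  shows "(\<And>x. f x \<noteq> 0) \<Longrightarrow> torus_smooth f \<Longrightarrow> torus_smooth (\<lambda>x. inverse (f x))"
  by (simp add: torus_smooth_def smooth_on_inverse periodic_def)

lemma torus_smooth_bounded_linear:
  "bounded_linear L \<Longrightarrow> torus_smooth f \<Longrightarrow> torus_smooth (\<lambda>x. L (f x))"
  by (simp add: torus_smooth_def smooth_on_bounded_linear periodic_def)

lemma torus_smooth_differentiable: "torus_smooth f \<Longrightarrow> f differentiable (at x)"
  by (simp add: torus_smooth_def smooth_differentiable)

lemma torus_smooth_continuous: "torus_smooth f \<Longrightarrow> continuous_on S f"
  using continuous_on_subset smooth_on_continuous torus_smooth_def by blast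

section \<open>Integration over the torus\<close>

lemma continuous_on_vector_2:
  assumes "continuous_on S f" "continuous_on S g"
  shows "continuous_on S (\<lambda>z. vector [f z, g z] :: real^2)"
proof -
  have eq: "(\<lambda>z. vector [f z, g z] :: real^2) = (\<lambda>z. \<chi> i. if i = 1 then f z else g z)"
    by (simp add: fun_eq_iff vec_eq_iff forall_2)
  have "continuous_on S (\<lambda>z. if i = 1 then f z else g z)" for i :: 2
    using assms by (cases "i = 1") auto
  then have "continuous_on S (\<lambda>z. (\<chi> i. if i = 1 then f z else g z) :: real^2)"
    by (intro continuous_on_vec_lambda)
  then show ?thesis unfolding eq .
qed

text \<open>Iterated integration takes place on pairs. The coordinate map between pairs and vectors
  sends boxes to boxes of the same area in both directions, which is what
  \<open>has_integral_twiddle\<close> asks for with factor 1.\<close>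

lemma has_integral_vector_2:
  fixes f :: "real^2 \<Rightarrow> 'b::euclidean_space"
  assumes "(f has_integral i) (cbox 0 1)"
  shows "((\<lambda>z. f (vector [fst z, snd z])) has_integral i) (cbox (0, 0) (1, 1))"
proof -
  let ?g = "\<lambda>z. vector [fst z, snd z] :: real^2" and ?h = "\<lambda>x::real^2. (x$1, x$2)"
  have g: "?g ` cbox u v = cbox (?g u) (?g v)" for u v :: "real \<times> real"
  proof
    show "?g ` cbox u v \<subseteq> cbox (?g u) (?g v)"
      by (auto simp: mem_box_cart forall_2 cbox_Pair_eq[of "fst u" "snd u" "fst v" "snd v", simplified])
    show "cbox (?g u) (?g v) \<subseteq> ?g ` cbox u v"
    proof
      fix x assume "x \<in> cbox (?g u) (?g v)"
      then have "(x$1, x$2) \<in> cbox u v"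
        using cbox_Pair_eq[of "fst u" "snd u" "fst v" "snd v"] by (auto simp: mem_box_cart forall_2)
      moreover have "x = ?g (x$1, x$2)"
        by (simp add: vec_eq_iff forall_2)
      ultimately show "x \<in> ?g ` cbox u v" by blast
    qed
  qed
  have hg: "?h (?g z) = z" for z by simp
  have gh: "?g (?h x) = x" for x by (simp add: vec_eq_iff forall_2)
  have h: "?h ` cbox u v = cbox (?h u) (?h v)" for u v :: "real^2"
  proof -
    have "cbox u v = ?g ` cbox (?h u) (?h v)"
      unfolding g gh ..
    then show ?thesis by (simp add: image_comp o_def)
  qed
  have r: "measure lborel (?g ` cbox u v) = 1 * measure lborel (cbox u v)" for u v
  proof (cases "cbox u v = {}")
    case False
    then have "cbox (?g u) (?g v) \<noteq> {}" unfolding g[symmetric] by blast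
    then have "measure lborel (cbox (?g u) (?g v)) = (fst v - fst u) * (snd v - snd u)"
      by (simp add: content_cbox_cart UNIV_2)
    moreover have "fst u \<le> fst v" "snd u \<le> snd v"
      using False cbox_Pair_eq[of "fst u" "snd u" "fst v" "snd v"] by auto
    then have "measure lborel (cbox u v) = (fst v - fst u) * (snd v - snd u)"
      using content_Pair[of "fst u" "snd u" "fst v" "snd v"] by simp
    ultimately show ?thesis unfolding g by simp
  qed simp
  have contg: "continuous (at z) ?g" for z
  proof -
    have "continuous_on UNIV ?g"
      by (intro continuous_on_vector_2 continuous_intros)
    then show ?thesis using continuous_on_eq_continuous_at[OF open_UNIV] by blast
  qed
  have "((\<lambda>z. f (?g z)) has_integral (1 / 1) *\<^sub>R i) (?h ` cbox 0 1)"
    by (rule has_integral_twiddle[of 1 ?h ?g, OF zero_less_one hg gh contg _ _ r assms])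
       (use g h in blast)+
  then show ?thesis unfolding h by simp
qed

text \<open>Both orders are stated because a derivative in direction i is integrated away in the
  inner integral, which then has to run over coordinate i.\<close>

lemma torus_integral_iterated:
  fixes f :: "real^2 \<Rightarrow> 'b::euclidean_space"
  assumes "continuous_on UNIV f"
  shows "torus_integral f = integral {0..1} (\<lambda>a. integral {0..1} (\<lambda>b. f (vector [a, b])))"
    and "torus_integral f = integral {0..1} (\<lambda>b. integral {0..1} (\<lambda>a. f (vector [a, b])))"
proof -
  have cont: "continuous_on S (\<lambda>(a, b). f (vector [a, b]))" for S
    unfolding split_beta
    by (intro continuous_on_compose2[OF assms continuous_on_vector_2] continuous_intros) auto
  have "f integrable_on cbox 0 1"
    using assms continuous_on_subset integrable_continuous by blast
  then have "torus_integral f = integral (cbox (0, 0) (1, 1)) (\<lambda>z. f (vector [fst z, snd z]))"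
    unfolding torus_integral_def
    by (rule integral_unique[OF has_integral_vector_2[OF integrable_integral], symmetric])
  also have "\<dots> = integral {0..1} (\<lambda>a. integral {0..1} (\<lambda>b. f (vector [a, b])))"
    using integral_prod_continuous[OF cont, of 0 0 1 1] by (simp add: case_prod_beta')
  finally show "torus_integral f = integral {0..1} (\<lambda>a. integral {0..1} (\<lambda>b. f (vector [a, b])))" .
  also have "\<dots> = integral {0..1} (\<lambda>b. integral {0..1} (\<lambda>a. f (vector [a, b])))"
    using integral_swap_continuous[OF cont, of 0 1 0 1] by simp
  finally show "torus_integral f = integral {0..1} (\<lambda>b. integral {0..1} (\<lambda>a. f (vector [a, b])))" .
qed

text \<open>Integrating along direction i first gives f(x + e_i) - f(x) by the fundamental theorem,
  and this is zero by periodicity. The form with a continuous derivative, rather than a smooth real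
  function, also covers complex waves and a merely C^1 truncation of the density.\<close>

lemma torus_integral_derivative:
  fixes f :: "real^2 \<Rightarrow> 'b::euclidean_space"
  assumes per: "periodic f"
    and der: "\<And>x. (f has_derivative f' x) (at x)"
    and cont: "continuous_on UNIV (\<lambda>x. f' x (axis i 1))"
  shows "torus_integral (\<lambda>x. f' x (axis i 1)) = 0"
proof -
  have line: "((\<lambda>h. f (x + h *\<^sub>R axis i 1)) has_vector_derivative f' (x + h *\<^sub>R axis i 1) (axis i 1))
      (at h within T)" for x h T
  proof -
    have g: "((\<lambda>h. x + h *\<^sub>R axis i 1) has_derivative (\<lambda>h. h *\<^sub>R axis i 1)) (at h within T)"
      by (auto intro!: derivative_eq_intros)
    show ?thesis
      unfolding has_vector_derivative_def
      using has_derivative_compose[OF g der] linear_cmul[OF has_derivative_linear[OF der]] by simp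
  qed
  have int0: "integral {0..1} (\<lambda>h. f' (x + h *\<^sub>R axis i 1) (axis i 1)) = 0" for x
  proof -
    have "((\<lambda>h. f' (x + h *\<^sub>R axis i 1) (axis i 1)) has_integral
        f (x + 1 *\<^sub>R axis i 1) - f (x + 0 *\<^sub>R axis i 1)) {0..1}"
      by (rule fundamental_theorem_of_calculus) (auto intro: line)
    then show ?thesis
      using per by (auto simp: periodic_def)
  qed
  consider "i = 1" | "i = 2" using exhaust_2 by blast
  then show ?thesis
  proof cases
    case 1
    have v: "vector [a, b] = vector [0, b] + a *\<^sub>R (axis i 1 :: real^2)" for a b :: real
      by (simp add: 1 vec_eq_iff forall_2 axis_def)
    show ?thesis
      by (subst torus_integral_iterated(2)[OF cont], subst v) (simp only: int0 integral_0)
  next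
    case 2
    have v: "vector [a, b] = vector [a, 0] + b *\<^sub>R (axis i 1 :: real^2)" for a b :: real
      by (simp add: 2 vec_eq_iff forall_2 axis_def)
    show ?thesis
      by (subst torus_integral_iterated(1)[OF cont], subst v) (simp only: int0 integral_0)
  qed
qed

lemma torus_integral_partial_deriv:
  assumes "torus_smooth f"
  shows "torus_integral (partial_deriv i f) = 0"
proof -
  have "torus_integral (\<lambda>x. axis i 1 \<bullet> grad f x) = 0"
    using assms
    by (intro torus_integral_derivative[where f = f] has_derivative_grad
          torus_smooth_differentiable)
       (use torus_smooth_continuous[OF torus_smooth_partial_deriv[OF assms]] assms in
          \<open>auto simp: inner_axis' grad_def torus_smooth_def\<close>)
  then show ?thesis
    by (simp add: inner_axis' grad_def)
qed

lemma torus_integral_const [simp]: "torus_integral (\<lambda>x. c) = c"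
  unfolding torus_integral_def by (simp add: content_cbox_cart interval_ne_empty_cart)

lemma torus_integral_add:
  "continuous_on UNIV f \<Longrightarrow> continuous_on UNIV g \<Longrightarrow>
    torus_integral (\<lambda>x. f x + g x) = torus_integral f + torus_integral g"
  unfolding torus_integral_def
  by (intro integral_add integrable_continuous) (auto intro: continuous_on_subset)

lemma torus_integral_diff:
  "continuous_on UNIV f \<Longrightarrow> continuous_on UNIV g \<Longrightarrow>
    torus_integral (\<lambda>x. f x - g x) = torus_integral f - torus_integral g"
  unfolding torus_integral_def
  by (intro integral_diff integrable_continuous) (auto intro: continuous_on_subset)

lemma torus_integral_bounded_linear:
  "bounded_linear L \<Longrightarrow> continuous_on UNIV f \<Longrightarrow>
    torus_integral (\<lambda>x. L (f x)) = L (torus_integral f)"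
  using integral_linear[of f "cbox 0 1" L] continuous_on_subset[of UNIV f "cbox 0 1"]
  unfolding torus_integral_def o_def by (simp add: integrable_continuous)

section \<open>Reduction of periodic functions to the unit square\<close>

lemma periodic_of_nat:
  assumes "periodic f"
  shows "f (x + of_nat n *\<^sub>R axis i 1) = f x"
proof (induction n)
  case (Suc n)
  have "x + of_nat (Suc n) *\<^sub>R axis i 1 = (x + of_nat n *\<^sub>R axis i 1) + axis i 1"
    by (simp add: algebra_simps)
  then show ?case
    using assms Suc unfolding periodic_def by metis
qed simp

lemma periodic_of_int:
  assumes "periodic f"
  shows "f (x + of_int k *\<^sub>R axis i 1) = f x"
proof (cases "k \<ge> 0")
  case True
  then show ?thesis using periodic_of_nat[OF assms, of x "nat k" i] by simp
next
  case False
  then show ?thesis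
    using periodic_of_nat[OF assms, of "x + of_int k *\<^sub>R axis i 1" "nat (- k)" i] by simp
qed

lemma periodic_representative:
  assumes "periodic f"
  shows "\<exists>y\<in>cbox 0 1. f y = f x"
proof
  let ?y = "x + of_int (- \<lfloor>x$1\<rfloor>) *\<^sub>R axis 1 1 + of_int (- \<lfloor>x$2\<rfloor>) *\<^sub>R axis 2 1"
  show "f ?y = f x" by (simp only: periodic_of_int[OF assms])
  show "?y \<in> cbox 0 1" by (simp add: mem_box_cart forall_2 axis_def) linarith
qed

lemma periodic_bounded:
  fixes f :: "real^2 \<Rightarrow> 'b::real_normed_vector"
  assumes "periodic f" "continuous_on UNIV f"
  obtains M where "\<And>x. norm (f x) \<le> M"
proof -
  have "bounded (f ` cbox 0 1)"
    using assms(2) continuous_on_subset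
    by (intro compact_imp_bounded compact_continuous_image) auto
  then obtain M where M: "\<forall>y\<in>cbox 0 1. norm (f y) \<le> M"
    by (auto simp: bounded_iff)
  have "norm (f x) \<le> M" for x
    using periodic_representative[OF assms(1), of x] M by metis
  then show ?thesis using that by blast
qed

lemma torus_integral_nonneg_eq_0:
  fixes f :: "real^2 \<Rightarrow> real"
  assumes "periodic f" "continuous_on UNIV f" "\<And>x. f x \<ge> 0" "torus_integral f = 0"
  shows "f x = 0"
proof -
  \<comment> \<open>The centre of the square witnesses that the open box is nonempty, as the
    vanishing criterion requires.\<close>
  have "(1/2) *\<^sub>R 1 \<in> box 0 (1::real^2)" by (simp add: mem_box_cart)
  then have "\<forall>x\<in>cbox 0 1. f x = 0"
    using integral_cbox_eq_0_iff[of 0 1 f] assms continuous_on_subset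
    unfolding torus_integral_def by blast
  then show ?thesis
    using periodic_representative[OF assms(1), of x] by metis
qed

text \<open>Differentiation under the integral within J, one-sided at endpoints; on a convex set a
  vanishing derivative means constancy.\<close>

lemma torus_integral_conserved:
  fixes g :: "real \<Rightarrow> real^2 \<Rightarrow> 'b::euclidean_space"
  assumes "is_interval J"
    and der: "\<And>t x. t \<in> J \<Longrightarrow> ((\<lambda>t. g t x) has_vector_derivative g' t x) (at t within J)"
    and cont: "continuous_on (J \<times> UNIV) (\<lambda>(t, x). g' t x)"
    and g: "\<And>t. t \<in> J \<Longrightarrow> continuous_on UNIV (g t)"
    and zero: "\<And>t. t \<in> J \<Longrightarrow> torus_integral (g' t) = 0"
    and "s \<in> J" "t \<in> J"
  shows "torus_integral (g s) = torus_integral (g t)"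
proof -
  have J: "convex J" using assms(1) by (simp add: is_interval_convex_1)
  have "((\<lambda>t. torus_integral (g t)) has_vector_derivative torus_integral (g' r)) (at r within J)"
    if "r \<in> J" for r
    unfolding torus_integral_def
    by (rule leibniz_rule_vector_derivative[OF _ _ _ that J])
       (auto intro!: der integrable_continuous intro: continuous_on_subset[OF g] continuous_on_subset[OF cont])
  then show ?thesis
    using has_derivative_zero_unique[OF J, of "\<lambda>t. torus_integral (g t)" s t] zero assms(6,7)
    by (simp add: has_vector_derivative_def)
qed

section \<open>Uniqueness for the weighted Laplacian\<close>

lemma divergence_diff:
  assumes "\<And>i. (\<lambda>y. v y $ i) differentiable (at x)" "\<And>i. (\<lambda>y. w y $ i) differentiable (at x)"
  shows "divergence (\<lambda>y. v y - w y) x = divergence v x - divergence w x"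
  unfolding divergence_def by (simp add: partial_deriv_diff assms sum_subtractf)

lemma torus_smooth_weighted_flux:
  assumes "torus_smooth \<rho>" "\<And>x. \<rho> x \<noteq> 0" "torus_smooth \<phi>"
  shows "torus_smooth (\<lambda>x. (inverse (\<rho> x) *\<^sub>R grad \<phi> x) $ i)"
  using assms by (simp add: grad_def torus_smooth_mult torus_smooth_inverse torus_smooth_partial_deriv)

text \<open>For a difference \<eta> with flux P = grad \<eta> / \<rho> of zero divergence, div
  (\<eta> P) equals |grad \<eta>|^2 / \<rho>. This is nonnegative and integrates to zero, so \<eta>
  is constant, and the mean condition makes the constant zero.\<close>

lemma weighted_laplacian_inj_on:
  assumes \<rho>: "torus_smooth \<rho>" "\<And>x. \<rho> x > 0"
  shows "inj_on (weighted_laplacian \<rho>) mean_zero"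
proof (rule inj_onI)
  fix \<phi> \<phi>'
  assume \<phi>: "\<phi> \<in> mean_zero" and \<phi>': "\<phi>' \<in> mean_zero"
    and eq: "weighted_laplacian \<rho> \<phi> = weighted_laplacian \<rho> \<phi>'"
  have \<rho>0: "\<rho> x \<noteq> 0" for x using \<rho>(2)[of x] by simp
  have sm: "torus_smooth \<phi>" "torus_smooth \<phi>'"
    using \<phi> \<phi>' by (auto simp: mean_zero_def)
  define \<eta> where "\<eta> = (\<lambda>x. \<phi> x - \<phi>' x)"
  have \<eta>: "torus_smooth \<eta>"
    unfolding \<eta>_def by (intro torus_smooth_diff sm)
  have grad: "grad \<eta> x = grad \<phi> x - grad \<phi>' x" for x
    by (simp add: \<eta>_def vec_eq_iff grad_def partial_deriv_diff torus_smooth_differentiable sm)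
  define P where "P = (\<lambda>i x. inverse (\<rho> x) * partial_deriv i \<eta> x)"
  have P: "torus_smooth (P i)" for i
    using torus_smooth_weighted_flux[OF \<rho>(1) \<rho>0 \<eta>] by (simp add: P_def grad_def)
  have "weighted_laplacian \<rho> \<eta> x = weighted_laplacian \<rho> \<phi> x - weighted_laplacian \<rho> \<phi>' x" for x
    unfolding weighted_laplacian_def grad scaleR_diff_right
    by (rule divergence_diff)
       (intro torus_smooth_differentiable torus_smooth_weighted_flux \<rho> \<rho>0 sm)+
  then have divP: "(\<Sum>i\<in>UNIV. partial_deriv i (P i) x) = 0" for x
    using fun_cong[OF eq, of x] by (simp add: weighted_laplacian_def divergence_def P_def grad_def)
  have energy: "(\<Sum>i\<in>UNIV. partial_deriv i (\<lambda>y. \<eta> y * P i y) x)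
      = inverse (\<rho> x) * (norm (grad \<eta> x))\<^sup>2" for x
  proof -
    have "(\<Sum>i\<in>UNIV. partial_deriv i (\<lambda>y. \<eta> y * P i y) x)
        = \<eta> x * (\<Sum>i\<in>UNIV. partial_deriv i (P i) x) + (\<Sum>i\<in>UNIV. partial_deriv i \<eta> x * P i x)"
      by (simp add: partial_deriv_mult torus_smooth_differentiable P \<eta> sum.distrib sum_distrib_left)
    also have "\<dots> = inverse (\<rho> x) * (norm (grad \<eta> x))\<^sup>2"
      unfolding divP by (simp add: P_def power2_norm_eq_inner inner_vec_def grad_def sum_2 algebra_simps)
    finally show ?thesis .
  qed
  have sm': "torus_smooth (partial_deriv i (\<lambda>y. \<eta> y * P i y))" for i
    by (intro torus_smooth_partial_deriv torus_smooth_mult \<eta> P)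
  have "torus_integral (\<lambda>x. \<Sum>i\<in>UNIV. partial_deriv i (\<lambda>y. \<eta> y * P i y) x) = 0"
    unfolding sum_2
    by (simp add: torus_integral_add torus_smooth_continuous sm' torus_integral_partial_deriv
          torus_smooth_mult \<eta> P)
  moreover have "torus_smooth (\<lambda>x. \<Sum>i\<in>UNIV. partial_deriv i (\<lambda>y. \<eta> y * P i y) x)"
    unfolding sum_2 by (intro torus_smooth_add sm')
  ultimately have "inverse (\<rho> x) * (norm (grad \<eta> x))\<^sup>2 = 0" for x
    unfolding energy
    using less_imp_le[OF \<rho>(2)]
    by (intro torus_integral_nonneg_eq_0[of "\<lambda>x. inverse (\<rho> x) * (norm (grad \<eta> x))\<^sup>2"])
       (simp_all add: torus_smooth_continuous, simp add: torus_smooth_def)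
  then have "grad \<eta> x = 0" for x
    using \<rho>0[of x] by auto
  then have "(\<eta> has_derivative (\<lambda>v. 0)) (at x)" for x
    using has_derivative_grad[OF torus_smooth_differentiable[OF \<eta>], of x] by simp
  then obtain c where c: "\<And>x. \<eta> x = c"
    using has_derivative_zero_constant[of UNIV \<eta>] by auto
  have "torus_integral \<eta> = torus_integral \<phi> - torus_integral \<phi>'"
    unfolding \<eta>_def by (intro torus_integral_diff torus_smooth_continuous sm)
  then have "torus_integral \<eta> = 0"
    using \<phi> \<phi>' by (simp add: mean_zero_def)
  moreover have "torus_integral \<eta> = c"
    using c torus_integral_const[of c] by (metis ext)
  ultimately have "\<eta> x = 0" for x using c by simp
  then show "\<phi> = \<phi>'" by (simp add: \<eta>_def fun_eq_iff)
qed

lemma laplacian_eq_weighted: "laplacian = weighted_laplacian (\<lambda>x. 1)"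
  by (simp add: fun_eq_iff laplacian_def weighted_laplacian_def)

lemma laplacian_inj_on: "inj_on laplacian mean_zero"
  unfolding laplacian_eq_weighted by (rule weighted_laplacian_inj_on) (auto intro: torus_smooth_const)

section \<open>Uniqueness of Fourier coefficients\<close>

definition wave :: "int \<Rightarrow> real \<Rightarrow> complex" where
  "wave k x = cis (2 * pi * of_int k * x)"

lemma wave_add: "wave k (x + y) = wave k x * wave k y"
  by (simp add: wave_def cis_mult algebra_simps)

lemma wave_mult: "wave j x * wave k x = wave (j + k) x"
  by (simp add: wave_def cis_mult algebra_simps)

lemma wave_0 [simp]: "wave 0 x = 1"
  by (simp add: wave_def)

lemma wave_one [simp]: "wave k 1 = 1"
  by (simp add: wave_def)

lemma wave_uminus: "wave (- k) x = wave k (- x)" "cnj (wave k x) = wave (- k) x"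
  by (simp_all add: wave_def cis_cnj)

lemma continuous_on_wave [continuous_intros]:
  "continuous_on S f \<Longrightarrow> continuous_on S (\<lambda>x. wave k (f x))"
  unfolding wave_def by (intro continuous_intros)

lemma integrable_Icc_of_continuous:
  fixes f :: "real \<Rightarrow> 'b::euclidean_space"
  shows "continuous_on UNIV f \<Longrightarrow> f integrable_on {a..b}"
  using continuous_on_subset integrable_continuous_real by blast

text \<open>Only the fractional part b of the shift matters; the piece of [b, 1 + b] beyond 1 is
  moved back by one period to [0, b].\<close>

lemma integral_period_translate:
  fixes f :: "real \<Rightarrow> 'b::euclidean_space"
  assumes per: "\<And>x. f (x + 1) = f x" and cont: "continuous_on UNIV f"
  shows "integral {0..1} (\<lambda>x. f (a + x)) = integral {0..1} f"
proof -
  interpret periodic_fun_simple' f by standard (rule per)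
  let ?b = "frac a"
  have b: "0 \<le> ?b" "?b \<le> 1" using frac_lt_1[of a] by (auto simp: less_imp_le)
  have int: "f integrable_on {c..d}" for c d
    using continuous_on_subset[OF cont] integrable_continuous_real by blast
  have "f (a + x) = f (x + ?b)" for x
    using plus_of_int[of "x + ?b" "\<lfloor>a\<rfloor>"] by (simp add: frac_def algebra_simps)
  then have "integral {0..1} (\<lambda>x. f (a + x)) = integral {0..1} (\<lambda>x. f (x + ?b))"
    by simp
  also have "\<dots> = integral {?b..1 + ?b} f"
    using integral_shift_real_ivl[of ?b ?b "1 + ?b" f] by simp
  also have "\<dots> = integral {?b..1} f + integral {1..1 + ?b} f"
    using b int by (intro Henstock_Kurzweil_Integration.integral_combine[symmetric]) auto
  also have "integral {1..1 + ?b} f = integral {0..?b} (\<lambda>x. f (x + 1))"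
    using integral_shift_real_ivl[of 1 1 "1 + ?b" f] by simp
  also have "\<dots> = integral {0..?b} f" by (simp only: per)
  also have "integral {?b..1} f + integral {0..?b} f = integral {0..1} f"
    using Henstock_Kurzweil_Integration.integral_combine[of 0 ?b 1 f] b int by (simp add: add.commute)
  finally show ?thesis .
qed

lemma integral_period_reflect:
  fixes f :: "real \<Rightarrow> 'b::euclidean_space"
  assumes per: "\<And>x. f (x + 1) = f x" and cont: "continuous_on UNIV f"
  shows "integral {0..1} (\<lambda>x. f (a - x)) = integral {0..1} f"
proof -
  have per': "f (- (x + 1)) = f (- x)" for x
    using per[of "- x - 1"] by simp
  have "integral {0..1} (\<lambda>x. f (- ((- a) + x))) = integral {0..1} (\<lambda>x. f (- x))"
    using per' continuous_on_compose2[OF cont, of UNIV uminus] continuous_on_minus[OF continuous_on_id]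
    by (intro integral_period_translate) auto
  also have "\<dots> = integral {-1..0} f"
    using Henstock_Kurzweil_Integration.integral_reflect_real[of 0 "-1" f] by simp
  also have "\<dots> = integral {0..1} (\<lambda>x. f (- 1 + x))"
    using integral_shift_real_ivl[of "-1" "-1" 0 f] by simp
  also have "\<dots> = integral {0..1} f"
    by (rule integral_period_translate[OF per cont])
  finally show ?thesis by simp
qed

text \<open>The cosine determines x in [0, 1] only up to the reflection x to 1 - x, which is
  harmless for a function invariant under that reflection.\<close>

lemma arccos_cos_2pi:
  assumes "0 \<le> x" "x \<le> (1::real)"
  shows "arccos (cos (2 * pi * x)) / (2 * pi) = x \<or> arccos (cos (2 * pi * x)) / (2 * pi) = 1 - x"
proof (cases "x \<le> 1/2")
  case True
  then have "2 * pi * x \<le> pi" by (simp add: mult.commute)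
  then show ?thesis using assms by (simp add: arccos_cos)
next
  case False
  have "cos (2 * pi * x) = cos (2 * pi * (1 - x))"
    by (simp add: right_diff_distrib cos_diff)
  moreover have "2 * pi * (1 - x) \<le> pi" using False by (simp add: mult.commute)
  then have "arccos (cos (2 * pi * (1 - x))) = 2 * pi * (1 - x)"
    using assms by (intro arccos_cos) auto
  ultimately show ?thesis by simp
qed

text \<open>An even function of period 1 is a continuous function of \<open>(1 + cos 2\<pi>x) / 2\<close>, hence by
  Bernstein a uniform limit of trigonometric polynomials; so it vanishes if it is orthogonal to
  all of them.\<close>

lemma fourier_unique_even:
  fixes g :: "real \<Rightarrow> real"
  assumes cont: "continuous_on UNIV g" and refl: "\<And>x. g (1 - x) = g x"
    and coef: "\<And>k. integral {0..1} (\<lambda>x. wave k x * of_real (g x)) = 0"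
  shows "g 0 = 0"
proof -
  define s where "s = (\<lambda>x::real. (1 + cos (2 * pi * x)) / 2)"
  \<comment> \<open>A collects the multipliers q for which q g is still orthogonal to every wave.
    All frequencies are demanded at once because multiplication by s shifts them by one in either
    direction.\<close>
  define A where "A = {q::real\<Rightarrow>real. continuous_on UNIV q \<and>
      (\<forall>k. integral {0..1} (\<lambda>x. wave k x * of_real (q x * g x)) = 0)}"
  have cont_s: "continuous_on UNIV s"
    unfolding s_def by (intro continuous_intros) auto
  have cont_wave: "continuous_on UNIV (\<lambda>x. wave k x * of_real (q x * g x))"
    if "continuous_on UNIV q" for k q
    by (intro continuous_intros that cont)
  have int: "(\<lambda>x. wave k x * of_real (q x * g x)) integrable_on {0..1}"
    if "continuous_on UNIV q" for k q
    using continuous_on_subset[OF cont_wave[OF that]] integrable_continuous_real by blast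
  have A_one: "(\<lambda>x. 1) \<in> A"
    using coef by (simp add: A_def)
  have A_lin: "(\<lambda>x. a * q x + b * r x) \<in> A" if "q \<in> A" "r \<in> A" for q r a b
  proof -
    have "integral {0..1} (\<lambda>x. wave k x * of_real ((a * q x + b * r x) * g x)) = 0" for k
    proof -
      have "(\<lambda>x. wave k x * of_real ((a * q x + b * r x) * g x))
          = (\<lambda>x. of_real a * (wave k x * of_real (q x * g x))
               + of_real b * (wave k x * of_real (r x * g x)))"
        by (simp add: fun_eq_iff algebra_simps)
      then show ?thesis
        using that int[of q k] int[of r k]
        by (simp add: A_def integral_add integrable_on_mult_right)
    qed
    then show ?thesis
      using that by (auto simp: A_def intro!: continuous_intros)
  qed
  have A_s: "(\<lambda>x. s x * q x) \<in> A" if "q \<in> A" for q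
  proof -
    have q: "continuous_on UNIV q" using that by (simp add: A_def)
    have "integral {0..1} (\<lambda>x. wave k x * of_real (s x * q x * g x)) = 0" for k
    proof -
      \<comment> \<open>Euler's formula turns s into a combination of the waves of frequency 0, 1
        and -1.\<close>
      have "wave 1 x + wave (- 1) x = of_real (2 * cos (2 * pi * x))" for x
        by (simp add: wave_def complex_eq_iff)
      then have s: "of_real (s x) = (2 + wave 1 x + wave (- 1) x) / 4" for x
        by (simp add: s_def add.assoc)
      have "wave k x * of_real (s x * q x * g x)
          = (1/2) * (wave k x * of_real (q x * g x))
          + ((1/4) * (wave (k + 1) x * of_real (q x * g x))
          + (1/4) * (wave (k - 1) x * of_real (q x * g x)))" for x
      proof -
        have "wave (k + 1) x = wave k x * wave 1 x" "wave (k - 1) x = wave k x * wave (- 1) x"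
          by (simp_all add: wave_mult)
        then show ?thesis
          unfolding of_real_mult s by (simp add: algebra_simps)
      qed
      then show ?thesis
        using that int[OF q]
        by (simp add: A_def integral_add integrable_on_mult_right integrable_add)
    qed
    then show ?thesis
      using q by (auto simp: A_def intro!: continuous_intros cont_s)
  qed
  have A_s': "(\<lambda>x. (1 - s x) * q x) \<in> A" if "q \<in> A" for q
    using A_lin[OF that A_s[OF that], of 1 "-1"] by (simp add: algebra_simps)
  have A_pow: "(\<lambda>x. s x ^ i * (1 - s x) ^ j) \<in> A" for i j
  proof (induction i)
    case 0
    show ?case
    proof (induction j)
      case (Suc j)
      then show ?case using A_s'[OF Suc] by (simp add: mult_ac)
    qed (simp add: A_one)
  next
    case (Suc i)
    then show ?case using A_s[OF Suc] by (simp add: mult_ac)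
  qed
  \<comment> \<open>The second summand of \<open>A_lin\<close> is a dummy with coefficient
    0.\<close>
  have A_Bernstein: "(\<lambda>x. c * Bernstein n k (s x)) \<in> A" for c n k
    using A_lin[OF A_pow A_pow, of "c * of_nat (n choose k)" k "n - k" 0 0 0]
    by (simp add: Bernstein_def mult_ac)
  have A_sum: "(\<lambda>x. \<Sum>k\<in>K. q k x) \<in> A" if "finite K" "\<And>k. q k \<in> A" for K :: "nat set" and q
    using that(1)
  proof (induction K)
    case empty
    show ?case using A_lin[OF A_one A_one, of 0 0] by simp
  next
    case (insert k K)
    then show ?case using A_lin[OF that(2)[of k] insert.IH, of 1 1] by simp
  qed
  \<comment> \<open>\<Phi> is g read as a function of \<sigma> = s(x). The inverse of s on half a
    period is arccos(2 \<sigma> - 1) / (2 pi), and the symmetry of g supplies the other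
    half.\<close>
  define \<Phi> where "\<Phi> = (\<lambda>\<sigma>. g (arccos (2 * \<sigma> - 1) / (2 * pi)))"
  have \<Phi>: "continuous_on {0..1} \<Phi>"
    unfolding \<Phi>_def by (intro continuous_on_compose2[OF cont] continuous_intros) auto
  have \<Phi>_s: "\<Phi> (s x) = g x" if "x \<in> {0..1}" for x
  proof -
    have "2 * s x - 1 = cos (2 * pi * x)" by (simp add: s_def field_simps)
    then show ?thesis
      using arccos_cos_2pi[of x] that refl by (auto simp: \<Phi>_def)
  qed
  have s01: "s x \<in> {0..1}" for x
  proof -
    have "0 \<le> 1 + cos (2 * pi * x)" using cos_ge_minus_one[of "2 * pi * x"] by linarith
    then show ?thesis by (simp add: s_def)
  qed
  have cont_g: "continuous_on {0..1} g" using continuous_on_subset[OF cont] by blast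
  have "bounded (g ` {0..1})"
    by (intro compact_imp_bounded compact_continuous_image cont_g) simp
  then obtain M where "\<forall>x\<in>{0..1}. \<bar>g x\<bar> \<le> M"
    by (auto simp: bounded_iff)
  then have M: "\<And>x. x \<in> {0..1} \<Longrightarrow> \<bar>g x\<bar> \<le> M" by blast
  have M0: "M \<ge> 0" using M[of 0] by simp
  \<comment> \<open>Since q g integrates to zero, the integral of g^2 equals that of (g - q) g,
    where |g - q| is at most e and |g| at most M.\<close>
  have small: "integral {0..1} (\<lambda>x. g x * g x) \<le> e * M" if "e > 0" for e
  proof -
    obtain n where n: "\<And>\<sigma>. \<sigma> \<in> {0..1} \<Longrightarrow> \<bar>\<Phi> \<sigma> - (\<Sum>k\<le>n. \<Phi> (k/n) * Bernstein n k \<sigma>)\<bar> < e"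
      using Bernstein_Weierstrass[OF \<Phi> \<open>e > 0\<close>] by blast
    define q where "q = (\<lambda>x. \<Sum>k\<le>n. \<Phi> (k/n) * Bernstein n k (s x))"
    have qA: "q \<in> A" unfolding q_def by (intro A_sum A_Bernstein) auto
    then have q: "continuous_on UNIV q" by (simp add: A_def)
    have "integral {0..1} (\<lambda>x. complex_of_real (q x * g x)) = 0"
      using qA unfolding A_def by (auto dest: spec[of _ 0])
    moreover have qg: "(\<lambda>x. q x * g x) integrable_on {0..1}"
      by (intro integrable_continuous_real continuous_on_subset[OF continuous_on_mult[OF q cont]]) auto
    ultimately have q0: "integral {0..1} (\<lambda>x. q x * g x) = 0"
      using integral_linear[OF qg bounded_linear_of_real[where 'a=complex]] by (simp add: o_def)
    have gg: "(\<lambda>x. g x * g x) integrable_on {0..1}"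
      by (intro integrable_continuous_real continuous_intros cont_g)
    have "integral {0..1} (\<lambda>x. g x * g x) = integral {0..1} (\<lambda>x. g x * g x - q x * g x)"
      using q0 integral_diff[OF gg qg] by simp
    also have "\<dots> \<le> integral {0..1} (\<lambda>x::real. e * M)"
    proof (rule integral_le)
      show "(\<lambda>x. g x * g x - q x * g x) integrable_on {0..1}"
        by (intro integrable_diff gg qg)
      show "g x * g x - q x * g x \<le> e * M" if "x \<in> {0..1}" for x
      proof -
        have "\<bar>g x - q x\<bar> \<le> e"
          using n[OF s01[of x]] \<Phi>_s[OF that] by (simp add: q_def less_imp_le)
        then have "\<bar>g x - q x\<bar> * \<bar>g x\<bar> \<le> e * M"
          using M[OF that] \<open>e > 0\<close> by (intro mult_mono) auto
        then show ?thesis by (simp add: left_diff_distrib abs_le_iff flip: abs_mult)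
      qed
    qed auto
    finally show ?thesis by simp
  qed
  have "integral {0..1} (\<lambda>x. g x * g x) \<le> 0"
  proof (rule field_le_epsilon)
    fix e :: real assume "e > 0"
    \<comment> \<open>Dividing by M + 1 rather than M covers the case M = 0.\<close>
    then have "integral {0..1} (\<lambda>x. g x * g x) \<le> e / (M + 1) * M"
      using M0 by (intro small) simp
    also have "\<dots> \<le> e"
      using M0 \<open>e > 0\<close> by (simp add: field_simps)
    finally show "integral {0..1} (\<lambda>x. g x * g x) \<le> 0 + e" by simp
  qed
  moreover have "integral {0..1} (\<lambda>x. g x * g x) \<ge> 0"
    by (intro integral_nonneg integrable_continuous_real continuous_intros cont_g) auto
  ultimately have "\<forall>x\<in>{0..1}. g x * g x = 0"
    using integral_eq_0_iff[of 0 1 "\<lambda>x. g x * g x"] continuous_on_mult[OF cont_g cont_g] by auto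
  then show ?thesis by simp
qed

text \<open>Symmetrising about a gives the even function h(a + x) + h(a - x), whose value at 0 is 2
  h(a). Translation and reflection multiply Fourier coefficients by a unit and possibly change the
  sign of the frequency, so all of its coefficients vanish too.\<close>

lemma fourier_unique_real:
  fixes h :: "real \<Rightarrow> real"
  assumes cont: "continuous_on UNIV h" and per: "\<And>x. h (x + 1) = h x"
    and coef: "\<And>k. integral {0..1} (\<lambda>x. wave k x * of_real (h x)) = 0"
  shows "h a = 0"
proof -
  let ?g = "\<lambda>x. h (a + x) + h (a - x)"
  have c: "continuous_on UNIV (\<lambda>x. wave k x * complex_of_real (h x))" for k
    by (intro continuous_intros cont)
  have p: "wave k (x + 1) * complex_of_real (h (x + 1)) = wave k x * complex_of_real (h x)" for k x
    by (simp add: wave_add per)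
  have ct: "continuous_on UNIV (\<lambda>x. h (a + x))" "continuous_on UNIV (\<lambda>x. h (a - x))"
    using continuous_on_compose2[OF cont, of UNIV "\<lambda>x. a + x"]
      continuous_on_compose2[OF cont, of UNIV "\<lambda>x. a - x"]
    by (simp_all add: continuous_on_add continuous_on_diff)
  have "integral {0..1} (\<lambda>x. wave k x * of_real (?g x)) = 0" for k
  proof -
    have 1: "wave k (- a) * (wave k (a + x) * z) = wave k x * z" for x z
      by (simp flip: wave_add mult.assoc)
    have 2: "wave k a * (wave (- k) (a - x) * z) = wave k x * z" for x z
      by (simp add: wave_uminus flip: wave_add mult.assoc)
    have "wave k x * of_real (?g x)
        = wave k (- a) * (wave k (a + x) * of_real (h (a + x)))
        + wave k a * (wave (- k) (a - x) * of_real (h (a - x)))" for x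
      unfolding 1 2 by (simp add: distrib_left)
    moreover have
      "integral {0..1} (\<lambda>x. wave k (a + x) * complex_of_real (h (a + x))) = 0"
      "integral {0..1} (\<lambda>x. wave (- k) (a - x) * complex_of_real (h (a - x))) = 0"
      using integral_period_translate[OF p c] integral_period_reflect[OF p c] coef by simp_all
    moreover have
      "(\<lambda>x. wave k (a + x) * complex_of_real (h (a + x))) integrable_on {0..1}"
      "(\<lambda>x. wave (- k) (a - x) * complex_of_real (h (a - x))) integrable_on {0..1}"
      by (intro integrable_Icc_of_continuous continuous_intros ct)+
    ultimately show ?thesis
      by (simp add: integral_add integrable_on_mult_right)
  qed
  then have c0: "\<forall>k. integral {0..1} (\<lambda>x. wave k x * of_real (?g x)) = 0" by blast
  have g1: "?g (1 - x) = ?g x" for x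
    using per[of "a - x"] per[of "a + x - 1"] by (simp add: algebra_simps)
  have cg: "continuous_on UNIV ?g"
    by (intro continuous_on_add ct)
  have "?g 0 = 0"
    by (rule fourier_unique_even[OF cg g1]) (use c0 in blast)
  then show ?thesis by simp
qed

text \<open>The real case is applied to Re (c h) for c = 1 and c = -i. The coefficients of a real
  part combine those of the function at k with the conjugates of those at -k, hence the use of all
  integer frequencies.\<close>

lemma fourier_unique_complex:
  fixes h :: "real \<Rightarrow> complex"
  assumes cont: "continuous_on UNIV h" and per: "\<And>x. h (x + 1) = h x"
    and coef: "\<And>k. integral {0..1} (\<lambda>x. wave k x * h x) = 0"
  shows "h a = 0"
proof -
  have Re0: "Re (c * h a) = 0" for c
  proof -
    let ?f = "\<lambda>k x. wave k x * (c * h x)"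
    have int: "?f k integrable_on {0..1}" for k
      by (intro integrable_Icc_of_continuous continuous_intros cont)
    have f0: "integral {0..1} (?f k) = 0" for k
      using coef[of k] integral_mult_right[of "{0..1}" c "\<lambda>x. wave k x * h x"]
      by (simp add: mult.left_commute)
    show ?thesis
    proof (rule fourier_unique_real[where h = "\<lambda>x. Re (c * h x)"])
      show "continuous_on UNIV (\<lambda>x. Re (c * h x))"
        by (intro continuous_intros cont)
      show "integral {0..1} (\<lambda>x. wave k x * of_real (Re (c * h x))) = 0" for k
      proof -
        have "wave k x * of_real (Re (c * h x)) = (1/2) * (?f k x) + (1/2) * cnj (?f (- k) x)" for x
        proof -
          have "complex_of_real (Re z) = (z + cnj z) / 2" for z
            by (simp add: complex_eq_iff)
          from this[of "c * h x"] show ?thesis by (simp only:) (simp add: wave_uminus algebra_simps)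
        qed
        moreover have "integral {0..1} (\<lambda>x. cnj (?f (- k) x)) = 0"
          using integral_linear[OF int[of "-k"] bounded_linear_cnj] f0[of "-k"] by (simp add: o_def)
        moreover have "(\<lambda>x. cnj (?f (- k) x)) integrable_on {0..1}"
          using integrable_linear[OF int[of "-k"] bounded_linear_cnj] by (simp add: o_def)
        ultimately show ?thesis
          using int[of k] f0[of k] by (simp only: integral_add integrable_on_mult_right integral_mult_right) simp
      qed
    qed (simp add: per)
  qed
  show ?thesis
    using Re0[of 1] Re0[of "- \<i>"] by (simp add: complex_eq_iff)
qed

section \<open>Fourier series on the torus\<close>

text \<open>Being linear in x, the phase also gives derivatives: differentiating the wave of
  frequency m in direction v multiplies it by i \<open>phase m v\<close>.\<close>

definition phase :: "int \<times> int \<Rightarrow> real^2 \<Rightarrow> real" where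
  "phase m x = 2 * pi * (of_int (fst m) * x $ 1 + of_int (snd m) * x $ 2)"

definition torus_wave :: "int \<times> int \<Rightarrow> real^2 \<Rightarrow> complex" where
  "torus_wave m x = cis (phase m x)"

definition fourier_coeff :: "(real^2 \<Rightarrow> complex) \<Rightarrow> int \<times> int \<Rightarrow> complex" where
  "fourier_coeff f m = torus_integral (\<lambda>x. torus_wave (- m) x * f x)"

lemma norm_torus_wave [simp]: "norm (torus_wave m x) = 1"
  by (simp add: torus_wave_def)

lemma torus_wave_mult: "torus_wave m x * torus_wave n x = torus_wave (m + n) x"
  by (simp add: torus_wave_def cis_mult phase_def algebra_simps)

lemma torus_wave_0 [simp]: "torus_wave 0 x = 1"
  by (simp add: torus_wave_def phase_def)

lemma torus_wave_vector: "torus_wave (j, k) (vector [a, b]) = wave j a * wave k b"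
  by (simp add: torus_wave_def wave_def cis_mult phase_def algebra_simps)

lemma bounded_linear_phase: "bounded_linear (phase m)"
  unfolding phase_def
  by (intro bounded_linear_const_mult bounded_linear_add bounded_linear_vec_nth)

lemma periodic_torus_wave: "periodic (torus_wave m)"
  unfolding periodic_def
proof (intro allI)
  fix x :: "real^2" and i :: 2
  have "phase m (axis i 1) = 2 * pi * of_int (if i = 1 then fst m else snd m)"
    using exhaust_2[of i] by (auto simp: phase_def axis_def)
  then have "cis (phase m (axis i 1)) = 1" by (simp only: cis_multiple_2pi Ints_of_int)
  moreover have "phase m (x + axis i 1) = phase m x + phase m (axis i 1)"
    using bounded_linear_phase by (simp add: linear_simps)
  ultimately show "torus_wave m (x + axis i 1) = torus_wave m x"
    by (simp add: torus_wave_def flip: cis_mult)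
qed

lemma has_derivative_torus_wave:
  "(torus_wave m has_derivative (\<lambda>v. \<i> * of_real (phase m v) * torus_wave m x)) (at x within S)"
proof -
  have "((\<lambda>x. cis (phase m x)) has_derivative (\<lambda>v. phase m v *\<^sub>R (\<i> * cis (phase m x)))) (at x within S)"
    by (intro has_derivative_cis bounded_linear_imp_has_derivative bounded_linear_phase)
  then show ?thesis
    by (simp add: torus_wave_def[abs_def] scaleR_conv_of_real mult_ac)
qed

lemma continuous_on_torus_wave [continuous_intros]: "continuous_on S (torus_wave m)"
  by (rule has_derivative_continuous_on[OF has_derivative_torus_wave])

lemma phase_axis_eq_0: "(\<forall>i. phase m (axis i 1) = 0) \<longleftrightarrow> m = 0"
  by (cases m) (auto simp: phase_def axis_def forall_2 zero_prod_def)

text \<open>For m \<noteq> 0 some partial derivative multiplies the wave by a nonzero constant, and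
  a derivative of a periodic function integrates to zero.\<close>

lemma torus_integral_torus_wave: "torus_integral (torus_wave m) = (if m = 0 then 1 else 0)"
proof (cases "m = 0")
  case True
  then have "torus_wave m = (\<lambda>x. 1)" by (simp add: fun_eq_iff)
  with True show ?thesis by simp
next
  case False
  then obtain i where i: "phase m (axis i 1) \<noteq> 0"
    using phase_axis_eq_0 by blast
  let ?c = "\<i> * complex_of_real (phase m (axis i 1))"
  have "torus_integral (\<lambda>x. ?c * torus_wave m x) = 0"
    by (intro torus_integral_derivative[of "torus_wave m"] periodic_torus_wave
        has_derivative_torus_wave continuous_intros)
  then have "?c * torus_integral (torus_wave m) = 0"
    by (subst (asm) torus_integral_bounded_linear[OF bounded_linear_mult_right])
       (auto intro: continuous_intros)
  then show ?thesis using i False by simp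
qed

text \<open>One-dimensional uniqueness is used twice. For fixed k, the k-th coefficient in the
  second variable, as a function of the first, has vanishing coefficients and so is zero; then for
  each a the function of the second variable has vanishing coefficients.\<close>

lemma fourier_unique:
  fixes h :: "real^2 \<Rightarrow> complex"
  assumes cont: "continuous_on UNIV h" and per: "periodic h"
    and coef: "\<And>m. fourier_coeff h m = 0"
  shows "h x = 0"
proof -
  have per1: "h (vector [a + 1, b]) = h (vector [a, b])"
    and per2: "h (vector [a, b + 1]) = h (vector [a, b])" for a b
  proof -
    have "vector [a + 1, b] = vector [a, b] + (axis 1 1 :: real^2)"
      "vector [a, b + 1] = vector [a, b] + (axis 2 1 :: real^2)"
      by (simp_all add: vec_eq_iff forall_2 axis_def)
    then show "h (vector [a + 1, b]) = h (vector [a, b])" "h (vector [a, b + 1]) = h (vector [a, b])"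
      using per unfolding periodic_def by simp_all
  qed
  have cont2: "continuous_on S (\<lambda>z. h (vector [f z, g z]))"
    if "continuous_on S f" "continuous_on S g" for S :: "'a::topological_space set" and f g
    by (intro continuous_on_compose2[OF cont continuous_on_vector_2] that) auto
  have inner: "integral {0..1} (\<lambda>b. wave k b * h (vector [a, b])) = 0" for a k
  proof (rule fourier_unique_complex[where h = "\<lambda>a. integral {0..1} (\<lambda>b. wave k b * h (vector [a, b]))"])
    have "continuous_on (UNIV \<times> cbox 0 1) (\<lambda>(a::real, b). wave k b * h (vector [a, b]))"
      unfolding case_prod_beta' by (intro continuous_intros cont2)
    then show "continuous_on UNIV (\<lambda>a. integral {0..1} (\<lambda>b. wave k b * h (vector [a, b])))"
      using integral_continuous_on_param[of UNIV 0 1 "\<lambda>a b. wave k b * h (vector [a, b])"] by simp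
    show "integral {0..1} (\<lambda>a. wave j a * integral {0..1} (\<lambda>b. wave k b * h (vector [a, b]))) = 0" for j
    proof -
      have "0 = torus_integral (\<lambda>x. torus_wave (j, k) x * h x)"
        using coef[of "- (j, k)"] by (simp add: fourier_coeff_def)
      also have "\<dots> = integral {0..1} (\<lambda>a. integral {0..1} (\<lambda>b. wave j a * (wave k b * h (vector [a, b]))))"
        by (subst torus_integral_iterated(1))
           (auto intro!: continuous_intros cont simp: torus_wave_vector mult.assoc)
      finally show ?thesis by simp
    qed
  qed (simp add: per1)
  have "h (vector [a, b]) = 0" for a b
    by (rule fourier_unique_complex[where h = "\<lambda>b. h (vector [a, b])"])
       (auto intro!: cont2 continuous_intros simp: per2 inner)
  moreover have "x = vector [x $ 1, x $ 2]"
    by (simp add: vec_eq_iff forall_2)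
  ultimately show ?thesis by metis
qed

subsection \<open>Rapidly decreasing coefficients\<close>

definition weight :: "int \<times> int \<Rightarrow> real" where
  "weight m = 1 + \<bar>of_int (fst m)\<bar> + \<bar>of_int (snd m)\<bar>"

definition rapidly_decreasing :: "(int \<times> int \<Rightarrow> complex) \<Rightarrow> bool" where
  "rapidly_decreasing a \<longleftrightarrow> (\<forall>N. \<exists>C. \<forall>m. weight m ^ N * norm (a m) \<le> C)"

lemma weight_ge_1: "weight m \<ge> 1"
  by (simp add: weight_def)

lemma phase_le_weight: "\<bar>phase m v\<bar> \<le> 2 * pi * weight m * norm v"
proof -
  have "\<bar>phase m v\<bar> = 2 * pi * \<bar>of_int (fst m) * v $ 1 + of_int (snd m) * v $ 2\<bar>"
    by (simp add: phase_def abs_mult)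
  also have "\<bar>of_int (fst m) * v $ 1 + of_int (snd m) * v $ 2\<bar>
      \<le> \<bar>of_int (fst m)\<bar> * \<bar>v $ 1\<bar> + \<bar>of_int (snd m)\<bar> * \<bar>v $ 2\<bar>"
    by (simp add: abs_triangle_ineq flip: abs_mult)
  also have "\<dots> \<le> \<bar>of_int (fst m)\<bar> * norm v + \<bar>of_int (snd m)\<bar> * norm v"
    by (intro add_mono mult_left_mono component_le_norm_cart) auto
  also have "\<dots> \<le> weight m * norm v"
    by (simp add: weight_def algebra_simps)
  finally show ?thesis by (simp add: mult.assoc mult_left_mono)
qed

text \<open>One differentiation costs one power of the weight.\<close>

lemma rapidly_decreasing_phase:
  assumes "rapidly_decreasing a"
  shows "rapidly_decreasing (\<lambda>m. \<i> * of_real (phase m v) * a m)"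
  unfolding rapidly_decreasing_def
proof
  fix N
  obtain C where C: "\<And>m. weight m ^ Suc N * norm (a m) \<le> C"
    using assms unfolding rapidly_decreasing_def by blast
  have "weight m ^ N * norm (\<i> * of_real (phase m v) * a m) \<le> 2 * pi * norm v * C" for m
  proof -
    have "weight m ^ N * norm (\<i> * of_real (phase m v) * a m)
        = \<bar>phase m v\<bar> * (weight m ^ N * norm (a m))"
      by (simp add: norm_mult)
    also have "\<dots> \<le> (2 * pi * weight m * norm v) * (weight m ^ N * norm (a m))"
      using weight_ge_1[of m] by (intro mult_right_mono phase_le_weight) auto
    also have "\<dots> = 2 * pi * norm v * (weight m ^ Suc N * norm (a m))"
      by simp
    also have "\<dots> \<le> 2 * pi * norm v * C"
      by (intro mult_left_mono C) auto
    finally show ?thesis .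
  qed
  then show "\<exists>C. \<forall>m. weight m ^ N * norm (\<i> * of_real (phase m v) * a m) \<le> C"
    by blast
qed

lemma rapidly_decreasing_mono:
  assumes "rapidly_decreasing a" "\<And>m. norm (b m) \<le> norm (a m)"
  shows "rapidly_decreasing b"
proof -
  have "weight m ^ N * norm (b m) \<le> weight m ^ N * norm (a m)" for m N
    using weight_ge_1[of m] by (intro mult_left_mono assms) auto
  then show ?thesis
    using assms(1) unfolding rapidly_decreasing_def by (meson order_trans)
qed

text \<open>An enumeration turns sums over the frequency lattice into series over the naturals, to
  which termwise differentiation and the Weierstrass test apply.\<close>

definition lattice_enum :: "nat \<Rightarrow> int \<times> int" where
  "lattice_enum n = map_prod int_decode int_decode (prod_decode n)"

lemma bij_lattice_enum: "bij lattice_enum"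
proof (rule o_bij)
  show "prod_encode \<circ> map_prod int_encode int_encode \<circ> lattice_enum = id"
  proof
    fix n
    show "(prod_encode \<circ> map_prod int_encode int_encode \<circ> lattice_enum) n = id n"
      by (cases "prod_decode n") (simp add: lattice_enum_def, metis prod_decode_inverse)
  qed
  show "lattice_enum \<circ> (prod_encode \<circ> map_prod int_encode int_encode) = id"
    by (auto simp: lattice_enum_def fun_eq_iff)
qed

text \<open>If n is the Cantor code of (a, b), then n is at most (a + b)^2 + (a + b). The coding of
  integers at most doubles absolute values, so a + b is at most twice the weight minus 2.\<close>

lemma lattice_enum_le_weight: "real n + 1 \<le> 4 * weight (lattice_enum n) ^ 2"
proof -
  obtain a b where ab: "prod_decode n = (a, b)" by fastforce
  have n: "n = triangle (a + b) + a"
    using arg_cong[OF ab, of prod_encode] unfolding prod_decode_inverse by (simp add: prod_encode_def)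
  have dec: "real c \<le> 2 * \<bar>of_int (int_decode c)\<bar>" for c
  proof -
    have "int (int_encode k) \<le> 2 * \<bar>k\<bar>" for k
      by (auto simp: int_encode_def sum_encode_def)
    then have "int c \<le> 2 * \<bar>int_decode c\<bar>"
      by (metis int_decode_inverse)
    then show ?thesis by (simp flip: of_int_abs)
  qed
  have w: "real (a + b) \<le> 2 * weight (lattice_enum n) - 2"
    using dec[of a] dec[of b] by (simp add: lattice_enum_def ab weight_def)
  have tri: "triangle k \<le> k * k" for k
    by (induction k) auto
  have "n \<le> (a + b) * (a + b) + (a + b)"
    using n tri[of "a + b"] by simp
  then have "real n \<le> real (a + b) * real (a + b) + real (a + b)"
    by (metis of_nat_add of_nat_le_iff of_nat_mult)
  also have "\<dots> \<le> (2 * weight (lattice_enum n) - 2) * (2 * weight (lattice_enum n) - 2)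
      + (2 * weight (lattice_enum n) - 2)"
    using w by (intro add_mono mult_mono) auto
  finally show ?thesis
    using weight_ge_1[of "lattice_enum n"] by (simp add: power2_eq_square algebra_simps)
qed

lemma summable_rapidly_decreasing:
  assumes "rapidly_decreasing a"
  shows "summable (\<lambda>n. weight (lattice_enum n) * norm (a (lattice_enum n)))"
    and "summable (\<lambda>n. norm (a (lattice_enum n)))"
proof -
  \<comment> \<open>Of the five powers, one pays for the weight in the sum and four for (n + 1)^2,
    which is at most 16 times the fourth power of the weight. What remains is dominated by the
    convergent series of 1 / (n + 1)^2.\<close>
  obtain C where C: "\<And>m. weight m ^ 5 * norm (a m) \<le> C"
    using assms unfolding rapidly_decreasing_def by blast
  show 1: "summable (\<lambda>n. weight (lattice_enum n) * norm (a (lattice_enum n)))"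
  proof (rule summable_comparison_test')
    show "summable (\<lambda>n. 16 * C * inverse (real (Suc n) ^ 2))"
      by (intro summable_mult) (rule summable_Suc_iff[THEN iffD2], rule inverse_power_summable, simp)
    show "norm (weight (lattice_enum n) * norm (a (lattice_enum n))) \<le> 16 * C * inverse (real (Suc n) ^ 2)"
      if "n \<ge> 0" for n
    proof -
      let ?w = "weight (lattice_enum n)" and ?a = "norm (a (lattice_enum n))"
      have w: "?w \<ge> 1" by (rule weight_ge_1)
      have "real (Suc n) ^ 2 * (?w * ?a) \<le> (4 * ?w ^ 2) ^ 2 * (?w * ?a)"
        using lattice_enum_le_weight[of n] w by (intro mult_right_mono power_mono) auto
      also have "\<dots> = 16 * (?w ^ 5 * ?a)"
        by (simp add: power_mult_distrib eval_nat_numeral)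
      also have "\<dots> \<le> 16 * C" using C by simp
      finally have "real (Suc n) ^ 2 * (?w * ?a) \<le> 16 * C" .
      moreover have "norm (?w * ?a) = ?w * ?a" using w by simp
      ultimately show ?thesis by (simp add: field_simps)
    qed
  qed
  show "summable (\<lambda>n. norm (a (lattice_enum n)))"
  proof (rule summable_comparison_test'[OF 1])
    show "norm (norm (a (lattice_enum n))) \<le> weight (lattice_enum n) * norm (a (lattice_enum n))"
      if "n \<ge> 0" for n
      using mult_right_mono[OF weight_ge_1[of "lattice_enum n"] norm_ge_zero[of "a (lattice_enum n)"]]
      by simp
  qed
qed

section \<open>Sums of rapidly decreasing Fourier series\<close>

definition fourier_series :: "(int \<times> int \<Rightarrow> complex) \<Rightarrow> real^2 \<Rightarrow> complex" where
  "fourier_series a x = (\<Sum>n. a (lattice_enum n) * torus_wave (lattice_enum n) x)"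

lemma summable_fourier_series:
  "rapidly_decreasing a \<Longrightarrow> summable (\<lambda>n. a (lattice_enum n) * torus_wave (lattice_enum n) x)"
  by (rule summable_norm_cancel) (simp add: norm_mult summable_rapidly_decreasing(2))

text \<open>The differentiated terms are bounded by \<open>?K n * norm v\<close> with
  \<open>?K\<close> summable and independent of x. Tails of \<open>?K\<close> thus give the error
  bound, uniform in x and linear in v, that termwise differentiation needs.\<close>

lemma fourier_series_has_derivative:
  assumes a: "rapidly_decreasing a"
  shows "(fourier_series a has_derivative
      (\<lambda>v. fourier_series (\<lambda>m. \<i> * of_real (phase m v) * a m) x)) (at x)"
proof -
  let ?f = "\<lambda>n x. a (lattice_enum n) * torus_wave (lattice_enum n) x"
  let ?f' = "\<lambda>n x v. \<i> * of_real (phase (lattice_enum n) v) * a (lattice_enum n) * torus_wave (lattice_enum n) x"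
  let ?K = "\<lambda>n. 2 * pi * (weight (lattice_enum n) * norm (a (lattice_enum n)))"
  have K: "summable ?K"
    by (intro summable_mult summable_rapidly_decreasing(1) a)
  have bound: "norm (?f' n x v) \<le> ?K n * norm v" for n x v
    using mult_right_mono[OF phase_le_weight[of "lattice_enum n" v] norm_ge_zero[of "a (lattice_enum n)"]]
    by (simp add: norm_mult mult_ac)
  have sf': "summable (\<lambda>n. ?f' n x v)" for x v
    by (rule summable_comparison_test'[OF summable_mult2[OF K, of "norm v"]]) (rule bound)
  have "\<exists>g. \<forall>x\<in>UNIV. (\<lambda>n. ?f n x) sums g x \<and>
      (g has_derivative (\<lambda>v. fourier_series (\<lambda>m. \<i> * of_real (phase m v) * a m) x)) (at x within UNIV)"
  proof (rule has_derivative_series)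
    show "(?f n has_derivative ?f' n x) (at x within UNIV)" for n x
      using has_derivative_mult_right[OF has_derivative_torus_wave[of "lattice_enum n" x UNIV], of "a (lattice_enum n)"]
      by (simp add: mult_ac)
    show "\<forall>\<^sub>F n in sequentially. \<forall>x\<in>UNIV. \<forall>h. norm ((\<Sum>i<n. ?f' i x h)
        - fourier_series (\<lambda>m. \<i> * of_real (phase m h) * a m) x) \<le> e * norm h" if "e > 0" for e
    proof -
      have "\<forall>\<^sub>F n in sequentially. norm ((\<Sum>i. ?K (i + n))) < e"
        using suminf_exist_split[OF that K] by (auto simp: eventually_sequentially)
      then show ?thesis
      proof (rule eventually_mono, intro ballI allI)
        fix n x h assume n: "norm (\<Sum>i. ?K (i + n)) < e"
        have Kn: "summable (\<lambda>i. ?K (i + n))"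
          using K by (rule summable_ignore_initial_segment)
        have "fourier_series (\<lambda>m. \<i> * of_real (phase m h) * a m) x - (\<Sum>i<n. ?f' i x h)
            = (\<Sum>i. ?f' (i + n) x h)"
          unfolding fourier_series_def using suminf_minus_initial_segment[OF sf'] by simp
        then have "norm ((\<Sum>i<n. ?f' i x h) - fourier_series (\<lambda>m. \<i> * of_real (phase m h) * a m) x)
            = norm (\<Sum>i. ?f' (i + n) x h)"
          by (simp add: norm_minus_commute)
        also have "\<dots> \<le> (\<Sum>i. ?K (i + n) * norm h)"
          by (intro norm_suminf_le bound summable_mult2 Kn)
        also have "\<dots> = (\<Sum>i. ?K (i + n)) * norm h"
          by (rule suminf_mult2[OF Kn, symmetric])
        also have "\<dots> \<le> e * norm h"
          using n by (intro mult_right_mono) auto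
        finally show "norm ((\<Sum>i<n. ?f' i x h)
            - fourier_series (\<lambda>m. \<i> * of_real (phase m h) * a m) x) \<le> e * norm h" .
      qed
    qed
    show "(\<lambda>n. ?f n 0) sums fourier_series a 0"
      unfolding fourier_series_def using summable_fourier_series[OF a] by blast
  qed auto
  then obtain g where g: "\<And>x. (\<lambda>n. ?f n x) sums g x"
    "\<And>x. (g has_derivative (\<lambda>v. fourier_series (\<lambda>m. \<i> * of_real (phase m v) * a m) x)) (at x)"
    by auto
  have "fourier_series a = g"
    using sums_unique[OF g(1)] by (simp add: fun_eq_iff fourier_series_def)
  then show ?thesis using g(2) by simp
qed

text \<open>Each directional derivative is again such a series with rapidly decreasing coefficients,
  so the induction on the order runs over all coefficient families at once.\<close>

lemma torus_smooth_fourier_series: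
  assumes "rapidly_decreasing a"
  shows "torus_smooth (fourier_series a)"
proof -
  have "Ck_on k UNIV (fourier_series a)" for k
    using assms
  proof (induction k arbitrary: a)
    case 0
    have "fourier_series a differentiable_on UNIV"
      using fourier_series_has_derivative[OF 0] by (auto simp: differentiable_on_def differentiable_def)
    then show ?case by (simp add: differentiable_imp_continuous_on)
  next
    case (Suc k)
    show ?case
      by (rule Ck_on_SucI[OF thick_UNIV fourier_series_has_derivative[OF Suc.prems]])
         (intro Suc.IH rapidly_decreasing_phase Suc.prems)
  qed
  then show ?thesis
    using periodic_torus_wave
    by (simp add: torus_smooth_def smooth_on_def periodic_def fourier_series_def)
qed

lemma fourier_series_add:
  assumes "rapidly_decreasing a" "rapidly_decreasing b"
  shows "fourier_series a x + fourier_series b x = fourier_series (\<lambda>m. a m + b m) x"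
  unfolding fourier_series_def
  by (subst suminf_add[OF summable_fourier_series summable_fourier_series])
     (simp_all add: assms distrib_right)

text \<open>Uniform convergence on the square permits termwise integration. By orthogonality only
  the index k of m contributes, so the integrals of the partial sums equal \<open>a m\<close> from k
  + 1 on.\<close>

lemma fourier_coeff_fourier_series:
  assumes a: "rapidly_decreasing a"
  shows "fourier_coeff (fourier_series a) m = a m"
proof -
  let ?f = "\<lambda>n x. a (lattice_enum n) * torus_wave (lattice_enum n) x"
  let ?g = "\<lambda>n x. \<Sum>i<n. a (lattice_enum i) * torus_wave (lattice_enum i - m) x"
  have eq: "torus_wave (- m) x * (\<Sum>i<n. ?f i x) = ?g n x" for n x
    by (simp add: sum_distrib_left mult.left_commute torus_wave_mult)
  have "uniform_limit (cbox 0 1) (\<lambda>n x. \<Sum>i<n. ?f i x) (fourier_series a) sequentially"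
    unfolding fourier_series_def
    by (rule Weierstrass_m_test[OF _ summable_rapidly_decreasing(2)[OF a]]) (simp add: norm_mult)
  then have "uniform_limit (cbox 0 1) (\<lambda>n x. torus_wave (- m) x * (\<Sum>i<n. ?f i x))
      (\<lambda>x. torus_wave (- m) x * fourier_series a x) sequentially"
    unfolding uniform_limit_iff dist_norm
    by (simp flip: right_diff_distrib add: norm_mult)
  then have ul: "uniform_limit (cbox 0 1) ?g (\<lambda>x. torus_wave (- m) x * fourier_series a x) sequentially"
    unfolding eq .
  obtain I J where I: "\<And>n. (?g n has_integral I n) (cbox 0 1)"
    and J: "((\<lambda>x. torus_wave (- m) x * fourier_series a x) has_integral J) (cbox 0 1)"
    and lim: "I \<longlonglongrightarrow> J"
  proof (rule uniform_limit_integral_cbox[OF ul])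
    show "continuous_on (cbox 0 1) (?g n)" for n
      by (intro continuous_intros)
  qed auto
  obtain k where k: "lattice_enum k = m"
    using bij_lattice_enum by (metis bij_pointE)
  have inj: "lattice_enum i = m \<longleftrightarrow> i = k" for i
    using bij_lattice_enum k by (metis bij_pointE)
  have "I n = (\<Sum>i<n. if i = k then a m else 0)" for n
  proof -
    have "I n = torus_integral (?g n)"
      unfolding torus_integral_def by (rule integral_unique[OF I, symmetric])
    also have "\<dots> = (\<Sum>i<n. a (lattice_enum i) * torus_integral (torus_wave (lattice_enum i - m)))"
      unfolding torus_integral_def
      by (subst integral_sum) (auto intro!: integrable_continuous continuous_intros)
    also have "\<dots> = (\<Sum>i<n. if i = k then a m else 0)"
      by (intro sum.cong refl) (simp add: torus_integral_torus_wave inj k)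
    finally show ?thesis .
  qed
  then have "I n = a m" if "n > k" for n
    using that by simp
  then have "I \<longlonglongrightarrow> a m"
    by (intro tendsto_eventually) (auto simp: eventually_sequentially intro!: exI[of _ "Suc k"])
  then have "J = a m"
    using lim LIMSEQ_unique by blast
  then show ?thesis
    using J by (auto simp: fourier_coeff_def torus_integral_def)
qed

subsection \<open>Decay of the coefficients of smooth functions\<close>

text \<open>Integration by parts: the derivative of the product of f with the wave of frequency -m
  integrates to zero, and the minus sign of the frequency cancels the one from moving the
  derivative.\<close>

lemma fourier_coeff_partial_deriv:
  assumes f: "torus_smooth f"
  shows "fourier_coeff (\<lambda>x. of_real (partial_deriv i f x)) m
      = \<i> * of_real (phase m (axis i 1)) * fourier_coeff (\<lambda>x. of_real (f x)) m"
proof -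
  let ?c = "\<i> * complex_of_real (phase m (axis i 1))"
  have neg: "phase (- m) v = - phase m v" for v
    by (simp add: phase_def algebra_simps)
  have cont: "continuous_on UNIV f" "continuous_on UNIV (partial_deriv i f)"
    using f by (auto intro: torus_smooth_continuous torus_smooth_partial_deriv)
  let ?D = "\<lambda>x v. torus_wave (- m) x * of_real (v \<bullet> grad f x)
      + \<i> * of_real (phase (- m) v) * torus_wave (- m) x * of_real (f x)"
  have D_eq: "?D x (axis i 1) = torus_wave (- m) x * of_real (partial_deriv i f x)
      - ?c * (torus_wave (- m) x * of_real (f x))" for x
    by (simp add: neg inner_axis' grad_def)
  have "torus_integral (\<lambda>x. ?D x (axis i 1)) = 0"
  proof (rule torus_integral_derivative)
    show "periodic (\<lambda>x. torus_wave (- m) x * complex_of_real (f x))"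
      using f periodic_torus_wave by (simp add: periodic_def torus_smooth_def)
    show "((\<lambda>x. torus_wave (- m) x * complex_of_real (f x)) has_derivative ?D x) (at x)" for x
      by (intro has_derivative_mult has_derivative_torus_wave has_derivative_of_real
            has_derivative_grad torus_smooth_differentiable f)
    show "continuous_on UNIV (\<lambda>x. ?D x (axis i 1))"
      unfolding D_eq by (intro continuous_intros cont)
  qed
  then have "fourier_coeff (\<lambda>x. of_real (partial_deriv i f x)) m
      - torus_integral (\<lambda>x. ?c * (torus_wave (- m) x * of_real (f x))) = 0"
    unfolding D_eq fourier_coeff_def
    by (subst (asm) torus_integral_diff) (auto intro!: continuous_intros cont)
  moreover have "torus_integral (\<lambda>x. ?c * (torus_wave (- m) x * of_real (f x)))
      = ?c * fourier_coeff (\<lambda>x. of_real (f x)) m"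
    unfolding fourier_coeff_def
    by (rule torus_integral_bounded_linear[OF bounded_linear_mult_right])
       (intro continuous_intros cont)
  ultimately show ?thesis by simp
qed

lemma fourier_coeff_iterated_partial_deriv:
  assumes "torus_smooth f"
  shows "fourier_coeff (\<lambda>x. of_real ((partial_deriv i ^^ N) f x)) m
      = (\<i> * of_real (phase m (axis i 1))) ^ N * fourier_coeff (\<lambda>x. of_real (f x)) m"
    and "torus_smooth ((partial_deriv i ^^ N) f)"
proof (induction N)
  case (Suc N)
  { case 1 show ?case using Suc by (simp add: fourier_coeff_partial_deriv) }
  { case 2 show ?case using Suc by (simp add: torus_smooth_partial_deriv) }
qed (use assms in auto)

lemma norm_fourier_coeff_le:
  assumes "continuous_on UNIV f" "\<And>x. norm (f x) \<le> M"
  shows "norm (fourier_coeff f m) \<le> M"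
proof -
  have "M \<ge> 0" using assms(2)[of 0] norm_ge_zero order_trans by blast
  then have "norm (integral (cbox 0 1) (\<lambda>x. torus_wave (- m) x * f x)) \<le> M * measure lborel (cbox 0 (1::real^2))"
    using assms continuous_on_subset[OF assms(1), of "cbox 0 1"]
    by (intro has_integral_bound[where f = "\<lambda>x. torus_wave (- m) x * f x"])
       (auto intro!: integrable_integral integrable_continuous continuous_intros simp: norm_mult)
  then show ?thesis
    by (simp add: fourier_coeff_def torus_integral_def content_cbox_cart interval_ne_empty_cart)
qed

text \<open>Coefficients of bounded functions are bounded; applied to f and to its N-th pure
  derivatives in both directions, this bounds the coefficient times 1 and times the N-th powers of
  the two axis phases.\<close>

lemma rapidly_decreasing_fourier_coeff:
  assumes f: "torus_smooth f"
  shows "rapidly_decreasing (fourier_coeff (\<lambda>x. of_real (f x)))"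
  unfolding rapidly_decreasing_def
proof
  fix N
  let ?c = "\<lambda>m. norm (fourier_coeff (\<lambda>x. complex_of_real (f x)) m)"
  have "\<exists>C. \<forall>m. \<bar>phase m (axis i 1)\<bar> ^ n * ?c m \<le> C" for i n
  proof -
    let ?g = "(partial_deriv i ^^ n) f"
    have g: "torus_smooth ?g" by (rule fourier_coeff_iterated_partial_deriv(2)[OF f])
    obtain C where C: "\<And>x. norm (?g x) \<le> C"
      using periodic_bounded[of ?g] g by (auto simp: torus_smooth_def smooth_on_continuous)
    have "norm (fourier_coeff (\<lambda>x. of_real (?g x)) m) \<le> C" for m
      using torus_smooth_continuous[OF g, of UNIV] C
      by (intro norm_fourier_coeff_le) (auto intro!: continuous_intros)
    then show ?thesis
      unfolding fourier_coeff_iterated_partial_deriv(1)[OF f]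
      by (auto simp: norm_mult norm_power)
  qed
  then obtain C0 C1 C2 where C0: "\<And>m. ?c m \<le> C0"
    and C1: "\<And>m. \<bar>phase m (axis 1 1)\<bar> ^ N * ?c m \<le> C1"
    and C2: "\<And>m. \<bar>phase m (axis 2 1)\<bar> ^ N * ?c m \<le> C2"
    by (metis power_0 mult_1)
  have "weight m ^ N * ?c m \<le> 3 ^ N * (C0 + C1 + C2)" for m
  proof -
    have p1: "\<bar>of_int (fst m)\<bar> \<le> \<bar>phase m (axis 1 1)\<bar>" and p2: "\<bar>of_int (snd m)\<bar> \<le> \<bar>phase m (axis 2 1)\<bar>"
    proof -
      have "\<bar>r\<bar> \<le> \<bar>2 * pi * r\<bar>" for r :: real
        using mult_right_mono[of 1 "2 * pi" "\<bar>r\<bar>"] pi_gt3 by (simp add: abs_mult)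
      then show "\<bar>of_int (fst m)\<bar> \<le> \<bar>phase m (axis 1 1)\<bar>" "\<bar>of_int (snd m)\<bar> \<le> \<bar>phase m (axis 2 1)\<bar>"
        by (simp_all add: phase_def axis_def)
    qed
    \<comment> \<open>The weight has three summands, each at most M, which explains the factor 3;
      and the N-th power of a maximum is at most the sum of the N-th powers.\<close>
    define M where "M = max 1 (max \<bar>phase m (axis 1 1)\<bar> \<bar>phase m (axis 2 1)\<bar>)"
    have M1: "1 \<le> M" "\<bar>phase m (axis 1 1)\<bar> \<le> M" "\<bar>phase m (axis 2 1)\<bar> \<le> M"
      by (auto simp: M_def)
    have "weight m \<le> 3 * M"
      using p1 p2 M1 unfolding weight_def by linarith
    then have "weight m ^ N \<le> 3 ^ N * M ^ N"
      unfolding power_mult_distrib[symmetric] using weight_ge_1[of m] by (intro power_mono) auto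
    moreover have "M ^ N \<le> 1 + \<bar>phase m (axis 1 1)\<bar> ^ N + \<bar>phase m (axis 2 1)\<bar> ^ N"
      by (auto simp: M_def max_def)
    ultimately have "weight m ^ N \<le> 3 ^ N * (1 + \<bar>phase m (axis 1 1)\<bar> ^ N + \<bar>phase m (axis 2 1)\<bar> ^ N)"
      by (meson order_trans mult_left_mono zero_le_power zero_le_numeral)
    then have "weight m ^ N * ?c m
        \<le> 3 ^ N * (1 + \<bar>phase m (axis 1 1)\<bar> ^ N + \<bar>phase m (axis 2 1)\<bar> ^ N) * ?c m"
      by (rule mult_right_mono) simp
    also have "\<dots> = 3 ^ N * (?c m + \<bar>phase m (axis 1 1)\<bar> ^ N * ?c m + \<bar>phase m (axis 2 1)\<bar> ^ N * ?c m)"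
      by (simp add: algebra_simps)
    also have "\<dots> \<le> 3 ^ N * (C0 + C1 + C2)"
      by (intro mult_left_mono add_mono C0 C1 C2) auto
    finally show ?thesis .
  qed
  then show "\<exists>C. \<forall>m. weight m ^ N * ?c m \<le> C" by blast
qed

section \<open>The Poisson equation\<close>

lemma partial_deriv_Re_fourier_series:
  assumes "rapidly_decreasing a"
  shows "partial_deriv i (\<lambda>x. Re (fourier_series a x))
      = (\<lambda>x. Re (fourier_series (\<lambda>m. \<i> * of_real (phase m (axis i 1)) * a m) x))"
proof
  fix x
  have "((\<lambda>x. Re (fourier_series a x)) has_derivative
      (\<lambda>v. Re (fourier_series (\<lambda>m. \<i> * of_real (phase m v) * a m) x))) (at x)"
    by (rule bounded_linear.has_derivative[OF bounded_linear_Re fourier_series_has_derivative[OF assms]])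
  then show "partial_deriv i (\<lambda>x. Re (fourier_series a x)) x
      = Re (fourier_series (\<lambda>m. \<i> * of_real (phase m (axis i 1)) * a m) x)"
    by (rule partial_deriv_eq)
qed

text \<open>The Laplacian multiplies the coefficient at m by -d(m). Off the zero frequency d is at
  least 1, so dividing by it keeps rapid decrease; at zero the coefficient of f vanishes by the mean
  condition, and the choice \<open>a 0 = 0\<close> makes the solution have mean zero.\<close>

lemma poisson_solvable:
  assumes f: "torus_smooth f" and mean: "torus_integral f = 0"
  obtains \<psi> where "\<psi> \<in> mean_zero" "laplacian \<psi> = f"
proof -
  define c where "c = fourier_coeff (\<lambda>x. of_real (f x))"
  have c: "rapidly_decreasing c"
    unfolding c_def by (rule rapidly_decreasing_fourier_coeff[OF f])
  have cont: "continuous_on UNIV f" using f by (rule torus_smooth_continuous)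
  have c0: "c 0 = 0"
    using torus_integral_bounded_linear[OF bounded_linear_of_real[where 'a=complex] cont] mean
    by (simp add: c_def fourier_coeff_def)
  define d where "d = (\<lambda>m. (phase m (axis 1 1))\<^sup>2 + (phase m (axis 2 1))\<^sup>2)"
  have d: "d m \<ge> 1" if "m \<noteq> 0" for m
  proof -
    have sq: "(2 * pi * of_int k)\<^sup>2 \<ge> 1" if "k \<noteq> 0" for k :: int
    proof -
      have "\<bar>of_int k\<bar> \<ge> (1::real)" using that by linarith
      then have "1 * 1 \<le> (2 * pi) * \<bar>of_int k :: real\<bar>"
        using pi_gt3 by (intro mult_mono) auto
      then have "1 \<le> \<bar>2 * pi * of_int k\<bar>" by (simp add: abs_mult)
      then show ?thesis using abs_le_square_iff[of 1 "2 * pi * of_int k"] by simp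
    qed
    show ?thesis
    proof (cases "fst m = 0")
      case True
      then have "snd m \<noteq> 0" using that by (auto simp: prod_eq_iff)
      then show ?thesis using sq[of "snd m"] True by (simp add: d_def phase_def axis_def)
    next
      case False
      then show ?thesis
        using sq[of "fst m"] by (auto simp: d_def phase_def axis_def intro: add_increasing2)
    qed
  qed
  define a where "a = (\<lambda>m. if m = 0 then 0 else - c m / of_real (d m))"
  have "norm (a m) \<le> norm (c m)" for m
  proof (cases "m = 0")
    case False
    then have "norm (c m) \<le> norm (c m) * d m"
      using d[of m] mult_left_mono[of 1 "d m" "norm (c m)"] by simp
    then show ?thesis
      using d[OF False] False by (simp add: a_def norm_divide field_simps)
  qed (simp add: a_def)
  then have a: "rapidly_decreasing a"
    using rapidly_decreasing_mono[OF c] by blast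
  \<comment> \<open>Taking the real part gives a real function without a symmetry argument on the
    coefficients; it commutes with the real operations used below.\<close>
  define \<psi> where "\<psi> = (\<lambda>x. Re (fourier_series a x))"
  have smooth: "torus_smooth \<psi>"
    unfolding \<psi>_def
    by (rule torus_smooth_bounded_linear[OF bounded_linear_Re torus_smooth_fourier_series[OF a]])
  have "torus_integral (fourier_series a) = a 0"
    using fourier_coeff_fourier_series[OF a, of 0] by (simp add: fourier_coeff_def)
  then have "torus_integral \<psi> = 0"
    unfolding \<psi>_def
    using torus_integral_bounded_linear[OF bounded_linear_Re
        torus_smooth_continuous[OF torus_smooth_fourier_series[OF a]]]
    by (simp add: a_def)
  with smooth have 1: "\<psi> \<in> mean_zero" by (simp add: mean_zero_def)
  let ?D = "\<lambda>i b m. \<i> * of_real (phase m (axis i 1)) * b m"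
  have D: "rapidly_decreasing (?D i b)" if "rapidly_decreasing b" for i :: 2 and b
    by (rule rapidly_decreasing_phase[OF that])
  have lap: "laplacian \<psi> x = Re (fourier_series c x)" for x
  proof -
    have "laplacian \<psi> x = (\<Sum>i\<in>UNIV. partial_deriv i (partial_deriv i \<psi>) x)"
      by (simp add: laplacian_def divergence_def grad_def)
    also have "\<dots> = (\<Sum>i\<in>UNIV. Re (fourier_series (?D i (?D i a)) x))"
      unfolding \<psi>_def by (simp only: partial_deriv_Re_fourier_series D a)
    also have "\<dots> = Re (fourier_series (?D 1 (?D 1 a)) x + fourier_series (?D 2 (?D 2 a)) x)"
      by (simp add: sum_2)
    also have "\<dots> = Re (fourier_series (\<lambda>m. ?D 1 (?D 1 a) m + ?D 2 (?D 2 a) m) x)"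
      by (simp only: fourier_series_add D a)
    also have "(\<lambda>m. ?D 1 (?D 1 a) m + ?D 2 (?D 2 a) m) = c"
    proof
      fix m
      have "?D 1 (?D 1 a) m + ?D 2 (?D 2 a) m = - of_real (d m) * a m"
        by (simp add: d_def power2_eq_square algebra_simps)
      also have "\<dots> = c m"
        using d[of m] c0 by (cases "m = 0") (auto simp: a_def)
      finally show "?D 1 (?D 1 a) m + ?D 2 (?D 2 a) m = c m" .
    qed
    finally show ?thesis .
  qed
  \<comment> \<open>f is recovered from its series by uniqueness: both sides have the same Fourier
    coefficients.\<close>
  have "fourier_series c x - of_real (f x) = 0" for x
  proof (rule fourier_unique[where h = "\<lambda>x. fourier_series c x - of_real (f x)"])
    note S = torus_smooth_fourier_series[OF c]
    show cont': "continuous_on UNIV (\<lambda>x. fourier_series c x - complex_of_real (f x))"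
      by (intro continuous_intros cont torus_smooth_continuous[OF S])
    show "periodic (\<lambda>x. fourier_series c x - complex_of_real (f x))"
      using S f by (simp add: torus_smooth_def periodic_def)
    show "fourier_coeff (\<lambda>x. fourier_series c x - complex_of_real (f x)) m = 0" for m
    proof -
      have "fourier_coeff (\<lambda>x. fourier_series c x - complex_of_real (f x)) m
          = fourier_coeff (fourier_series c) m - c m"
      proof -
        have "fourier_coeff (\<lambda>x. fourier_series c x - complex_of_real (f x)) m
            = torus_integral (\<lambda>x. torus_wave (- m) x * fourier_series c x)
              - torus_integral (\<lambda>x. torus_wave (- m) x * complex_of_real (f x))"
          unfolding fourier_coeff_def right_diff_distrib
          by (intro torus_integral_diff continuous_intros cont torus_smooth_continuous[OF S])
        then show ?thesis by (simp add: c_def fourier_coeff_def)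
      qed
      then show ?thesis by (simp add: fourier_coeff_fourier_series[OF c])
    qed
  qed
  then have "fourier_series c x = of_real (f x)" for x by simp
  then have "laplacian \<psi> = f" using lap by (simp add: fun_eq_iff)
  with 1 show ?thesis using that by blast
qed

section \<open>Functions on space-time\<close>

lemma at_within_interval_ne_bot:
  fixes J :: "real set"
  assumes "is_interval J" "t0 \<in> J" "J \<noteq> {t0}" "t \<in> J"
  shows "at t within J \<noteq> bot"
proof -
  have "t islimpt J"
    unfolding islimpt_approachable
  proof (intro allI impI)
    fix e :: real assume "e > 0"
    then obtain d where "0 < \<bar>d\<bar>" "\<bar>d\<bar> < e" "t + d \<in> J"
      using interval_accumulates[OF assms] by blast
    then show "\<exists>x'\<in>J. x' \<noteq> t \<and> dist x' t < e"
      by (intro bexI[of _ "t + d"]) (auto simp: dist_real_def)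
  qed
  then show ?thesis by (simp add: trivial_limit_within)
qed

text \<open>Reduces a statement at t to a compact interval inside J, where the fundamental theorem
  is available. At an endpoint of J one takes a = t or b = t, so one-sided derivatives stay
  one-sided.\<close>

lemma interval_subinterval_nhd:
  fixes J :: "real set"
  assumes J: "is_interval J" and t: "t \<in> J"
  obtains a b where "a \<in> J" "b \<in> J" "a \<le> t" "t \<le> b" "at t within J = at t within {a..b}"
proof -
  have sub: "y \<in> J" if "a \<in> J" "b \<in> J" "a \<le> y" "y \<le> b" for a b y
    using J that unfolding is_interval_1 by blast
  \<comment> \<open>If J has a point to the left of t, that point serves as both a and l; otherwise
    a = t and l = t - 1.\<close>
  obtain a l where a: "a \<in> J" "a \<le> t" "l < t" "\<And>y. y \<in> J \<Longrightarrow> l < y \<Longrightarrow> a \<le> y"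
  proof (cases "\<exists>a\<in>J. a < t")
    case True
    then show ?thesis using that by (metis less_imp_le)
  next
    case False
    then show ?thesis using that[of t "t - 1"] t by (auto simp: not_less)
  qed
  obtain b r where b: "b \<in> J" "t \<le> b" "t < r" "\<And>y. y \<in> J \<Longrightarrow> y < r \<Longrightarrow> y \<le> b"
  proof (cases "\<exists>b\<in>J. t < b")
    case True
    then show ?thesis using that by (metis less_imp_le)
  next
    case False
    then show ?thesis using that[of t "t + 1"] t by (auto simp: not_less)
  qed
  have "at t within J = at t within {a..b}"
  proof (rule at_within_nhd)
    show "t \<in> {l<..<r}" using a b by simp
    show "J \<inter> {l<..<r} - {t} = {a..b} \<inter> {l<..<r} - {t}"
    proof (intro set_eqI iffI)
      fix y assume "y \<in> J \<inter> {l<..<r} - {t}"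
      then show "y \<in> {a..b} \<inter> {l<..<r} - {t}"
        using a(4)[of y] b(4)[of y] by simp
    next
      fix y assume "y \<in> {a..b} \<inter> {l<..<r} - {t}"
      then show "y \<in> J \<inter> {l<..<r} - {t}"
        using sub[OF a(1) b(1), of y] by simp
    qed
  qed simp
  then show ?thesis using that a b by blast
qed

text \<open>Differentiating \<open>g b h - g a h = \<integral>\<^sub>a\<^sup>b \<partial>\<^sub>t g s h ds\<close> in \<open>h\<close> under the integral
  shows that \<open>\<partial>\<^sub>h g\<close> is an antiderivative of \<open>\<partial>\<^sub>h \<partial>\<^sub>t g\<close>, also at the endpoints of the interval.\<close>

lemma mixed_derivatives_commute:
  fixes g gt gth :: "real \<Rightarrow> real \<Rightarrow> real"
  assumes J: "is_interval J" and t: "t \<in> J"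
    and gt: "\<And>s h. s \<in> J \<Longrightarrow> ((\<lambda>s. g s h) has_vector_derivative gt s h) (at s within J)"
    and gh: "\<And>s. s \<in> J \<Longrightarrow> ((\<lambda>h. g s h) has_vector_derivative gh s) (at 0)"
    and gth: "\<And>s h. s \<in> J \<Longrightarrow> ((\<lambda>h. gt s h) has_vector_derivative gth s h) (at h)"
    and cont: "continuous_on (J \<times> UNIV) (\<lambda>(s, h). gth s h)"
  shows "(gh has_vector_derivative gth t 0) (at t within J)"
proof -
  obtain a b where ab: "a \<in> J" "b \<in> J" "a \<le> t" "t \<le> b" and nhd: "at t within J = at t within {a..b}"
    using interval_subinterval_nhd[OF J t] by metis
  have sub: "{a..b} \<subseteq> J"
  proof
    fix y assume "y \<in> {a..b}"
    then show "y \<in> J"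
      using J ab(1,2) unfolding is_interval_1 atLeastAtMost_iff by blast
  qed
  have ftc: "((\<lambda>s. gt s h) has_integral (g r h - g a h)) {a..r}" if "r \<in> {a..b}" for r h
    using that sub
    by (intro fundamental_theorem_of_calculus has_vector_derivative_within_subset[OF gt]) auto
  have antideriv: "gh r = gh a + integral {a..r} (\<lambda>s. gth s 0)" if r: "r \<in> {a..b}" for r
  proof -
    have sub': "{a..r} \<subseteq> J" using r sub by auto
    have "((\<lambda>h. integral (cbox a r) (\<lambda>s. gt s h)) has_vector_derivative
        integral (cbox a r) (\<lambda>s. gth s 0)) (at 0 within UNIV)"
    proof (rule leibniz_rule_vector_derivative)
      show "((\<lambda>h. gt s h) has_vector_derivative gth s h) (at h within UNIV)"
        if "s \<in> cbox a r" for h s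
        using gth that sub' by auto
      show "(\<lambda>s. gt s h) integrable_on cbox a r" for h
        using ftc[OF r, of h] by auto
      have "continuous_on (UNIV \<times> cbox a r) (\<lambda>z. (\<lambda>(s, h). gth s h) (snd z, fst z))"
        using sub' by (intro continuous_on_compose2[OF cont] continuous_intros) auto
      then show "continuous_on (UNIV \<times> cbox a r) (\<lambda>(h, s). gth s h)"
        by (simp add: case_prod_beta')
    qed auto
    moreover have "integral (cbox a r) (\<lambda>s. gt s h) = g r h - g a h" for h
      using ftc[OF r, of h] by (simp add: integral_unique)
    ultimately have "((\<lambda>h. g r h - g a h) has_vector_derivative integral {a..r} (\<lambda>s. gth s 0)) (at 0)"
      by simp
    moreover have "((\<lambda>h. g r h - g a h) has_vector_derivative gh r - gh a) (at 0)"
      using r sub ab by (intro has_vector_derivative_diff gh) auto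
    ultimately show ?thesis
      using vector_derivative_unique_at by (metis add.commute diff_add_cancel)
  qed
  have "continuous_on {a..b} (\<lambda>s. (\<lambda>(s, h). gth s h) (s, 0))"
    using sub by (intro continuous_on_compose2[OF cont] continuous_intros) auto
  then have "((\<lambda>r. gh a + integral {a..r} (\<lambda>s. gth s 0)) has_vector_derivative gth t 0)
      (at t within {a..b})"
    using ab integral_has_vector_derivative[of a b "\<lambda>s. gth s 0" t]
    by (auto intro!: derivative_eq_intros)
  then have "(gh has_vector_derivative gth t 0) (at t within {a..b})"
    by (rule has_vector_derivative_transform[rotated 2]) (use ab in simp, rule antideriv)
  then show ?thesis by (simp add: nhd)
qed

section \<open>Time and space derivatives of smooth functions on space-time\<close>

definition time_interval :: "real set \<Rightarrow> bool" where
  "time_interval J \<longleftrightarrow> is_interval J \<and> 0 \<in> J \<and> J \<noteq> {0}"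

abbreviation spacetime_smooth :: "real set \<Rightarrow> (real \<Rightarrow> real^2 \<Rightarrow> 'b::real_normed_vector) \<Rightarrow> bool" where
  "spacetime_smooth J f \<equiv> smooth_on (J \<times> UNIV) (\<lambda>(t, x). f t x)"

lemma thick_spacetime: "time_interval J \<Longrightarrow> thick (J \<times> (UNIV :: 'a::euclidean_space set))"
  unfolding time_interval_def using thick_time by blast

lemma spacetime_smooth_slice:
  assumes "spacetime_smooth J f" "t \<in> J"
  shows "smooth_on UNIV (f t)"
proof -
  have "bounded_linear (\<lambda>x::real^2. (0::real, x))"
    by (intro bounded_linear_Pair bounded_linear_zero bounded_linear_ident)
  then have "smooth_on UNIV (\<lambda>x. (\<lambda>(t, x). f t x) ((t, 0) + (0, x)))"
    using assms by (intro smooth_on_affine[where S = "J \<times> UNIV"]) auto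
  then show ?thesis by simp
qed

lemma spacetime_has_vector_derivative:
  assumes "spacetime_smooth J f" "t \<in> J"
  shows "((\<lambda>s. f s x) has_vector_derivative
      frechet_derivative (\<lambda>(t, x). f t x) (at (t, x) within J \<times> UNIV) (1, 0)) (at t within J)"
proof -
  let ?F' = "frechet_derivative (\<lambda>(t, x). f t x) (at (t, x) within J \<times> UNIV)"
  have F: "((\<lambda>(t, x). f t x) has_derivative ?F') (at (t, x) within J \<times> UNIV)"
    using smooth_on_has_derivative assms by blast
  have g: "((\<lambda>s. (s, x)) has_derivative (\<lambda>h. (h, 0))) (at t within J)"
    by (auto intro!: derivative_eq_intros)
  have "((\<lambda>s. (\<lambda>(t, x). f t x) (s, x)) has_derivative (\<lambda>h. ?F' (h, 0))) (at t within J)"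
    by (rule has_derivative_in_compose[OF g has_derivative_subset[OF F]]) auto
  then have "((\<lambda>s. f s x) has_derivative (\<lambda>h. ?F' (h, 0))) (at t within J)"
    by simp
  moreover have "(\<lambda>h. ?F' (h, 0)) = (\<lambda>h. h *\<^sub>R ?F' (1, 0))"
  proof
    show "?F' (h, 0) = h *\<^sub>R ?F' (1, 0)" for h
      using linear_cmul[OF has_derivative_linear[OF F], of h "(1, 0)"]
      by (simp only: scaleR_Pair real_scaleR_def mult_1_right scaleR_zero_right)
  qed
  ultimately show ?thesis unfolding has_vector_derivative_def by metis
qed

text \<open>\<open>vector_derivative\<close> is a choice as well; it is determined because t is a
  limit point of J.\<close>

lemma time_derivI:
  assumes "time_interval J" "t \<in> J"
    and "((\<lambda>s. f s x) has_vector_derivative d) (at t within J)"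
  shows "time_deriv J f t x = d"
  using assms at_within_interval_ne_bot[of J 0 t]
  by (simp add: time_deriv_def time_interval_def vector_derivative_within)

lemma has_time_deriv:
  assumes "time_interval J" "spacetime_smooth J f" "t \<in> J"
  shows "((\<lambda>s. f s x) has_vector_derivative time_deriv J f t x) (at t within J)"
proof -
  note D = spacetime_has_vector_derivative[OF assms(2,3), of x]
  show ?thesis unfolding time_derivI[where f = f and x = x, OF assms(1,3) D] by (rule D)
qed

lemma spacetime_smooth_time_deriv:
  assumes "time_interval J" "spacetime_smooth J f"
  shows "spacetime_smooth J (time_deriv J f)"
  by (rule smooth_on_cong[OF smooth_on_frechet_derivative[OF assms(2), of "(1, 0)"]])
     (auto simp: time_derivI[where f = f, OF assms(1) _ spacetime_has_vector_derivative[OF assms(2)]])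

lemma spacetime_smooth_partial_deriv:
  fixes f :: "real \<Rightarrow> real^2 \<Rightarrow> real"
  assumes "spacetime_smooth J f"
  shows "spacetime_smooth J (\<lambda>t. partial_deriv i (f t))"
proof (rule smooth_on_cong[OF smooth_on_frechet_derivative[OF assms, of "(0, axis i 1)"]])
  fix z assume z: "z \<in> J \<times> (UNIV :: (real^2) set)"
  obtain t x where tx: "z = (t, x)" "t \<in> J" using z by auto
  let ?F' = "frechet_derivative (\<lambda>(t, x). f t x) (at (t, x) within J \<times> UNIV)"
  have F: "((\<lambda>(t, x). f t x) has_derivative ?F') (at (t, x) within J \<times> UNIV)"
    using smooth_on_has_derivative[OF assms] tx by blast
  have g: "((\<lambda>x. (t, x)) has_derivative (\<lambda>v. (0, v))) (at x)"
    by (auto intro!: derivative_eq_intros)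
  have "((\<lambda>x. (\<lambda>(t, x). f t x) (t, x)) has_derivative (\<lambda>v. ?F' (0, v))) (at x)"
    by (rule has_derivative_in_compose[OF g has_derivative_subset[OF F]]) (use tx in auto)
  then have "(f t has_derivative (\<lambda>v. ?F' (0, v))) (at x)" by simp
  from partial_deriv_eq[OF this, of i]
  show "frechet_derivative (\<lambda>(t, x). f t x) (at z within J \<times> UNIV) (0, axis i 1)
      = (case z of (t, x) \<Rightarrow> partial_deriv i (f t) x)"
    by (simp add: tx)
qed

lemma has_vector_derivative_partial_deriv:
  assumes "smooth_on UNIV f"
  shows "((\<lambda>h. f (x + h *\<^sub>R axis i 1)) has_vector_derivative partial_deriv i f (x + h *\<^sub>R axis i 1)) (at h)"
proof -
  have g: "((\<lambda>h. x + h *\<^sub>R axis i 1) has_derivative (\<lambda>h. h *\<^sub>R axis i 1)) (at h)"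
    by (auto intro!: derivative_eq_intros)
  have "((\<lambda>h. f (x + h *\<^sub>R axis i 1)) has_derivative
      (\<lambda>k. (k *\<^sub>R axis i 1) \<bullet> grad f (x + h *\<^sub>R axis i 1))) (at h)"
    by (rule has_derivative_compose[OF g has_derivative_grad[OF smooth_differentiable[OF assms]]])
  then show ?thesis
    by (simp add: has_vector_derivative_def inner_axis' grad_def)
qed

lemma time_deriv_partial_deriv:
  fixes f :: "real \<Rightarrow> real^2 \<Rightarrow> real"
  assumes J: "time_interval J" and f: "spacetime_smooth J f" and t: "t \<in> J"
  shows "time_deriv J (\<lambda>t. partial_deriv i (f t)) t x = partial_deriv i (time_deriv J f t) x"
proof -
  note ft = spacetime_smooth_time_deriv[OF J f]
  have cont: "continuous_on (J \<times> UNIV) (\<lambda>z. (\<lambda>(t, x). partial_deriv i (time_deriv J f t) x)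
      (fst z, x + snd z *\<^sub>R axis i 1))"
    by (intro continuous_on_compose2[OF smooth_on_continuous[OF spacetime_smooth_partial_deriv[OF ft]]]
        continuous_intros) auto
  have "((\<lambda>s. partial_deriv i (f s) x) has_vector_derivative
      partial_deriv i (time_deriv J f t) (x + 0 *\<^sub>R axis i 1)) (at t within J)"
  proof (rule mixed_derivatives_commute[where g = "\<lambda>s h. f s (x + h *\<^sub>R axis i 1)"
        and gt = "\<lambda>s h. time_deriv J f s (x + h *\<^sub>R axis i 1)"
        and gth = "\<lambda>s h. partial_deriv i (time_deriv J f s) (x + h *\<^sub>R axis i 1)"])
    show "((\<lambda>s. f s (x + h *\<^sub>R axis i 1)) has_vector_derivative time_deriv J f s (x + h *\<^sub>R axis i 1))
        (at s within J)" if "s \<in> J" for s h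
      by (rule has_time_deriv[OF J f that])
    show "((\<lambda>h. f s (x + h *\<^sub>R axis i 1)) has_vector_derivative partial_deriv i (f s) x) (at 0)"
      if "s \<in> J" for s
      using has_vector_derivative_partial_deriv[OF spacetime_smooth_slice[OF f that], of x i 0] by simp
    show "((\<lambda>h. time_deriv J f s (x + h *\<^sub>R axis i 1)) has_vector_derivative
        partial_deriv i (time_deriv J f s) (x + h *\<^sub>R axis i 1)) (at h)" if "s \<in> J" for s h
      by (rule has_vector_derivative_partial_deriv[OF spacetime_smooth_slice[OF ft that]])
    show "continuous_on (J \<times> UNIV) (\<lambda>(s, h). partial_deriv i (time_deriv J f s) (x + h *\<^sub>R axis i 1))"
      using cont by (simp add: case_prod_beta')
  qed (use J t in \<open>auto simp: time_interval_def\<close>)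
  then show ?thesis
    by (intro time_derivI[OF J t]) simp
qed

text \<open>Translation along the j-th axis plays the role of time: for F t x = f(x + t e_j) on the
  whole time line, the time derivative at 0 is the j-th partial derivative. The symmetry is then the
  exchange of time and space derivatives.\<close>

lemma partial_deriv_commute:
  assumes f: "smooth_on UNIV f"
  shows "partial_deriv i (partial_deriv j f) x = partial_deriv j (partial_deriv i f) x"
proof -
  have UNIV: "time_interval UNIV"
    using infinite_UNIV_char_0[where 'a=real] by (auto simp: time_interval_def)
  let ?F = "\<lambda>t x. f (x + t *\<^sub>R axis j 1)"
  have "bounded_linear (\<lambda>z::real \<times> (real^2). snd z + fst z *\<^sub>R axis j 1)"
    by (intro bounded_linear_add bounded_linear_snd bounded_linear_scaleR_const bounded_linear_fst)
  then have "smooth_on UNIV (\<lambda>z::real \<times> (real^2). f (0 + (snd z + fst z *\<^sub>R axis j 1)))"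
    by (intro smooth_on_affine[where S = UNIV]) (auto simp: f)
  then have F: "spacetime_smooth UNIV ?F"
    by (simp add: case_prod_beta')
  have td: "time_deriv UNIV (\<lambda>t x. g (x + t *\<^sub>R axis j 1)) 0 y = partial_deriv j g y"
    if "smooth_on UNIV g" for g y
    using has_vector_derivative_partial_deriv[OF that, of y j 0]
    by (intro time_derivI[OF UNIV]) auto
  have "partial_deriv i (?F t) = (\<lambda>y. partial_deriv i f (y + t *\<^sub>R axis j 1))" for t
    by (simp add: partial_deriv_def fun_eq_iff add_ac)
  then have "time_deriv UNIV (\<lambda>t y. partial_deriv i f (y + t *\<^sub>R axis j 1)) 0 x
      = partial_deriv i (time_deriv UNIV ?F 0) x"
    using time_deriv_partial_deriv[OF UNIV F, of 0 i x] by simp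
  moreover have "time_deriv UNIV ?F 0 = partial_deriv j f"
    using td[OF f] by (simp add: fun_eq_iff)
  ultimately show ?thesis
    using td[OF smooth_partial_deriv[OF f], of i x] by simp
qed

section \<open>Helmholtz decomposition and the weighted Leray projector\<close>

lemma harmonic_mean_zero:
  assumes "w \<in> mean_zero" "\<And>x. laplacian w x = 0"
  shows "w x = 0"
proof -
  have "(\<lambda>x. 0) \<in> mean_zero" by (simp add: mean_zero_def torus_smooth_const)
  moreover have "laplacian w = laplacian (\<lambda>x. 0)"
    using assms(2) by (simp add: fun_eq_iff laplacian_def divergence_def grad_def)
  ultimately show ?thesis
    using inj_onD[OF laplacian_inj_on] assms(1) by metis
qed

text \<open>The remainder \<open>w\<close> after subtracting both potentials has neither curl nor divergence, so its
  components are harmonic.\<close>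

lemma helmholtz_decomposition:
  fixes v :: "real^2 \<Rightarrow> real^2"
  assumes v: "\<And>i. (\<lambda>x. v x $ i) \<in> mean_zero"
    and \<psi>: "\<psi> \<in> mean_zero" "laplacian \<psi> = curl v"
    and q: "q \<in> mean_zero" "laplacian q = divergence v"
  shows "v x = perp_grad \<psi> x + grad q x"
proof -
  have sm: "torus_smooth (\<lambda>x. v x $ i)" "torus_smooth \<psi>" "torus_smooth q" for i
    using v \<psi> q by (auto simp: mean_zero_def)
  have d: "torus_smooth (partial_deriv i \<psi>)" "torus_smooth (partial_deriv i q)" for i
    by (intro torus_smooth_partial_deriv sm)+
  define w1 where "w1 = (\<lambda>x. v x $ 1 + partial_deriv 2 \<psi> x - partial_deriv 1 q x)"
  define w2 where "w2 = (\<lambda>x. v x $ 2 - partial_deriv 1 \<psi> x - partial_deriv 2 q x)"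
  have w: "torus_smooth w1" "torus_smooth w2"
    unfolding w1_def w2_def by (intro torus_smooth_add torus_smooth_diff sm d)+
  note pd = partial_deriv_add partial_deriv_diff torus_smooth_differentiable torus_smooth_add
    torus_smooth_diff sm d
  note comm = partial_deriv_commute[of \<psi> 2 1] partial_deriv_commute[of q 2 1]
  have smU: "smooth_on UNIV \<psi>" "smooth_on UNIV q" "smooth_on UNIV w1" "smooth_on UNIV w2"
    using sm w by (auto simp: torus_smooth_def)
  have lap: "laplacian f y = partial_deriv 1 (partial_deriv 1 f) y + partial_deriv 2 (partial_deriv 2 f) y"
    for f y
    by (simp add: laplacian_def divergence_def grad_def sum_2)
  \<comment> \<open>In the divergence of the remainder the mixed derivatives of \<psi> cancel, and
    in its curl those of q. Together the two identities are Cauchy-Riemann equations for w1 and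
    w2.\<close>
  have div: "partial_deriv 1 w1 y = - partial_deriv 2 w2 y" for y
    using fun_cong[OF q(2), of y] unfolding lap
    by (simp add: w1_def w2_def pd comm smU divergence_def sum_2)
  have curl: "partial_deriv 1 w2 y = partial_deriv 2 w1 y" for y
    using fun_cong[OF \<psi>(2), of y] unfolding lap
    by (simp add: w1_def w2_def pd comm smU curl_def)
  have div': "partial_deriv 1 w1 = (\<lambda>y. - partial_deriv 2 w2 y)"
    "partial_deriv 2 w2 = (\<lambda>y. - partial_deriv 1 w1 y)"
    and curl': "partial_deriv 1 w2 = partial_deriv 2 w1"
    using div curl by auto
  have diff: "partial_deriv i w1 differentiable at y" "partial_deriv i w2 differentiable at y" for i y
    using w by (auto intro: torus_smooth_differentiable torus_smooth_partial_deriv)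
  have "laplacian w1 y = 0" for y
  proof -
    have "partial_deriv 1 (partial_deriv 1 w1) y = - partial_deriv 1 (partial_deriv 2 w2) y"
      by (subst div'(1)) (rule partial_deriv_minus[OF diff(2)])
    also have "partial_deriv 1 (partial_deriv 2 w2) y = partial_deriv 2 (partial_deriv 2 w1) y"
      by (subst partial_deriv_commute[OF smU(4)]) (simp add: curl')
    finally show ?thesis by (simp add: lap)
  qed
  moreover have "laplacian w2 y = 0" for y
  proof -
    have "partial_deriv 2 (partial_deriv 2 w2) y = - partial_deriv 2 (partial_deriv 1 w1) y"
      by (subst div'(2)) (rule partial_deriv_minus[OF diff(1)])
    also have "partial_deriv 2 (partial_deriv 1 w1) y = partial_deriv 1 (partial_deriv 1 w2) y"
      by (subst partial_deriv_commute[OF smU(3)]) (simp add: curl')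
    finally show ?thesis by (simp add: lap)
  qed
  \<comment> \<open>The subtracted potentials are derivatives and integrate to zero, so the
    remainder inherits the mean of v. A constant part of v would be invisible to its curl and
    divergence.\<close>
  moreover have "torus_integral w1 = 0" "torus_integral w2 = 0"
    using v unfolding w1_def w2_def
    by (simp_all add: torus_integral_add torus_integral_diff torus_smooth_continuous
          torus_smooth_add torus_smooth_diff sm d torus_integral_partial_deriv mean_zero_def)
  ultimately have "w1 x = 0" "w2 x = 0"
    using w harmonic_mean_zero[of w1 x] harmonic_mean_zero[of w2 x] unfolding mean_zero_def by blast+
  then show ?thesis
    by (simp add: w1_def w2_def vec_eq_iff forall_2 perp_grad_def grad_def)
qed

lemma weighted_leray_stream_function:
  fixes u :: "real^2 \<Rightarrow> real^2"
  assumes \<rho>: "torus_smooth \<rho>" "\<And>x. \<rho> x > 0"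
    and u: "\<And>i. torus_smooth (\<lambda>x. u x $ i)" "\<And>x. divergence u x = 0"
    and mean: "\<And>i. torus_integral (\<lambda>x. \<rho> x * u x $ i) = 0"
  shows "u x = weighted_leray \<rho>
      (\<lambda>y. inverse (\<rho> y) *\<^sub>R perp_grad (inv_laplacian (curl (\<lambda>x. \<rho> x *\<^sub>R u x))) y) x"
proof -
  let ?v = "\<lambda>x. \<rho> x *\<^sub>R u x"
  have \<rho>0: "\<rho> x \<noteq> 0" for x using \<rho>(2)[of x] by simp
  have v: "torus_smooth (\<lambda>x. ?v x $ i)" for i
    using torus_smooth_mult[OF \<rho>(1) u(1)] by simp
  have d: "torus_smooth (partial_deriv j (\<lambda>x. ?v x $ i))" for i j
    by (rule torus_smooth_partial_deriv[OF v])
  have v0: "(\<lambda>x. ?v x $ i) \<in> mean_zero" for i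
    using v[of i] mean by (simp add: mean_zero_def)
  have "torus_smooth (curl ?v)" "torus_integral (curl ?v) = 0"
    unfolding curl_def[abs_def]
    by (intro torus_smooth_diff d)
       (simp add: torus_integral_diff torus_smooth_continuous[OF d] torus_integral_partial_deriv[OF v]
         del: vector_scaleR_component)
  then obtain \<psi> where \<psi>: "\<psi> \<in> mean_zero" "laplacian \<psi> = curl ?v"
    by (rule poisson_solvable)
  have "torus_smooth (divergence ?v)" "torus_integral (divergence ?v) = 0"
    unfolding divergence_def[abs_def] sum_2
    by (intro torus_smooth_add d)
       (simp add: torus_integral_add torus_smooth_continuous[OF d] torus_integral_partial_deriv[OF v]
         del: vector_scaleR_component)
  then obtain q where q: "q \<in> mean_zero" "laplacian q = divergence ?v"
    by (rule poisson_solvable)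
  have inv: "inv_laplacian (curl ?v) = \<psi>"
    unfolding inv_laplacian_def \<psi>(2)[symmetric]
    by (rule the_inv_into_f_f[OF laplacian_inj_on \<psi>(1)])
  have helm: "?v y = perp_grad \<psi> y + grad q y" for y
    by (rule helmholtz_decomposition[OF v0 \<psi> q])
  have w: "inverse (\<rho> y) *\<^sub>R perp_grad \<psi> y = u y - inverse (\<rho> y) *\<^sub>R grad q y" for y
  proof -
    have "perp_grad \<psi> y = \<rho> y *\<^sub>R u y - grad q y"
      using helm[of y] by simp
    then show ?thesis using \<rho>0[of y] by (simp add: scaleR_diff_right)
  qed
  have q': "torus_smooth q" "torus_integral q = 0"
    using q(1) by (auto simp: mean_zero_def)
  have nq: "(\<lambda>x. - q x) \<in> mean_zero"
    using q' torus_integral_bounded_linear[OF bounded_linear_minus[OF bounded_linear_ident] torus_smooth_continuous[OF q'(1)]]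
    by (simp add: mean_zero_def torus_smooth_minus)
  have grad_nq: "grad (\<lambda>x. - q x) y = - grad q y" for y
    by (simp add: grad_def vec_eq_iff partial_deriv_minus torus_smooth_differentiable q')
  have flux: "torus_smooth (\<lambda>x. (inverse (\<rho> x) *\<^sub>R grad q x) $ i)" for i
    by (rule torus_smooth_weighted_flux[OF \<rho>(1) \<rho>0 q'(1)])
  have "divergence (\<lambda>y. inverse (\<rho> y) *\<^sub>R perp_grad \<psi> y) y
      = weighted_laplacian \<rho> (\<lambda>x. - q x) y" for y
  proof -
    have "divergence (\<lambda>y. inverse (\<rho> y) *\<^sub>R perp_grad \<psi> y) y
        = divergence u y - divergence (\<lambda>y. inverse (\<rho> y) *\<^sub>R grad q y) y"
      unfolding w
      by (intro divergence_diff torus_smooth_differentiable u(1) flux)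
    also have "\<dots> = - divergence (\<lambda>y. inverse (\<rho> y) *\<^sub>R grad q y) y"
      by (simp add: u(2))
    also have "\<dots> = weighted_laplacian \<rho> (\<lambda>x. - q x) y"
      unfolding weighted_laplacian_def grad_nq divergence_def scaleR_minus_right vector_uminus_component
      by (subst partial_deriv_minus[OF torus_smooth_differentiable[OF flux]]) (simp add: sum_negf)
    finally show ?thesis .
  qed
  \<comment> \<open>The pointwise identity makes the argument a value of
    \<open>weighted_laplacian\<close> on \<open>mean_zero\<close>, which is where the inverse is
    specified.\<close>
  then have "inv_weighted_laplacian \<rho> (divergence (\<lambda>y. inverse (\<rho> y) *\<^sub>R perp_grad \<psi> y)) = (\<lambda>x. - q x)"
    unfolding inv_weighted_laplacian_def
    using the_inv_into_f_f[OF weighted_laplacian_inj_on[OF \<rho>] nq] by presburger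
  then show ?thesis
    unfolding weighted_leray_def inv by (simp add: w grad_nq)
qed

section \<open>Conservation laws\<close>

text \<open>In every sign case the first-order remainder is at most (r - s)^2, which gives
  differentiability across the kink at 0 as well. The square is what smooths the positive part to
  C^1.\<close>

lemma has_derivative_positive_part_squared:
  "((\<lambda>s::real. (max 0 s)\<^sup>2) has_derivative (\<lambda>h. 2 * max 0 s * h)) (at s)"
proof (rule has_derivativeI_sandwich[of 1])
  show "bounded_linear (\<lambda>h. 2 * max 0 s * h)" by (rule bounded_linear_mult_right)
  show "((\<lambda>r. norm (r - s)) \<longlongrightarrow> 0) (at s)"
    using tendsto_norm[OF LIM_offset_zero_iff[THEN iffD2]] by (auto intro!: tendsto_eq_intros)
  show "norm ((max 0 r)\<^sup>2 - (max 0 s)\<^sup>2 - 2 * max 0 s * (r - s)) / norm (r - s) \<le> norm (r - s)"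
    if "r \<noteq> s" for r
  proof -
    have "\<bar>(max 0 r)\<^sup>2 - (max 0 s)\<^sup>2 - 2 * max 0 s * (r - s)\<bar> \<le> (r - s)\<^sup>2"
    proof -
      consider "r \<ge> 0" "s \<ge> 0" | "r < 0" "s \<ge> 0" | "s < 0" by linarith
      then show ?thesis
      proof cases
        case 1
        then have "(max 0 r)\<^sup>2 - (max 0 s)\<^sup>2 - 2 * max 0 s * (r - s) = (r - s)\<^sup>2"
          by (simp add: max_def power2_eq_square algebra_simps)
        then show ?thesis by simp
      next
        case 2
        then have e: "(max 0 r)\<^sup>2 - (max 0 s)\<^sup>2 - 2 * max 0 s * (r - s) = s * (s - 2 * r)"
          by (simp add: max_def power2_eq_square algebra_simps)
        have "s * (s - 2 * r) \<ge> 0" using 2 by (intro mult_nonneg_nonneg) auto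
        moreover have "s * (s - 2 * r) \<le> (r - s)\<^sup>2"
          by (simp add: power2_eq_square algebra_simps)
        ultimately show ?thesis unfolding e by simp
      next
        case 3
        then have e: "(max 0 r)\<^sup>2 - (max 0 s)\<^sup>2 - 2 * max 0 s * (r - s) = (max 0 r)\<^sup>2"
          by (simp add: max_def)
        have "max 0 r \<le> \<bar>r - s\<bar>" using 3 by (auto simp: max_def)
        then have "(max 0 r)\<^sup>2 \<le> \<bar>r - s\<bar>\<^sup>2" by (intro power_mono) auto
        then show ?thesis unfolding e by simp
      qed
    qed
    then show ?thesis
      using that by (simp add: divide_le_eq power2_eq_square flip: abs_mult)
  qed
qed auto

text \<open>The integral of \<open>(c - \<rho>)\<^sub>+\<^sup>2\<close> is conserved by divergence-free transport, and it vanishes exactly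
  when \<open>\<rho> \<ge> c\<close>; this avoids the flow map.\<close>

lemma transport_lower_bound:
  assumes J: "time_interval J" and t: "t \<in> J"
    and \<rho>: "spacetime_smooth J \<rho>" "\<And>t. t \<in> J \<Longrightarrow> periodic (\<rho> t)"
    and u: "\<And>t i. t \<in> J \<Longrightarrow> torus_smooth (\<lambda>x. u t x $ i)"
    and div: "\<And>t x. t \<in> J \<Longrightarrow> divergence (u t) x = 0"
    and transport: "\<And>t x. t \<in> J \<Longrightarrow> time_deriv J \<rho> t x + u t x \<bullet> grad (\<rho> t) x = 0"
    and init: "\<And>x. \<rho> 0 x \<ge> c"
  shows "\<rho> t x \<ge> c"
proof -
  define \<phi> where "\<phi> = (\<lambda>s::real. (max 0 (c - s))\<^sup>2)"
  define \<phi>' where "\<phi>' = (\<lambda>s::real. - (2 * max 0 (c - s)))"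
  have d\<phi>: "(\<phi> has_derivative (\<lambda>h. \<phi>' s * h)) (at s)" for s
  proof -
    have "((\<lambda>s. c - s) has_derivative (\<lambda>h. - h)) (at s)"
      by (auto intro!: derivative_eq_intros)
    from has_derivative_compose[OF this has_derivative_positive_part_squared] show ?thesis
      by (simp add: \<phi>_def \<phi>'_def)
  qed
  have c\<phi>: "continuous_on S (\<lambda>x. \<phi> (f x))" "continuous_on S (\<lambda>x. \<phi>' (f x))"
    if "continuous_on S f" for S and f :: "'a::topological_space \<Rightarrow> real"
    unfolding \<phi>_def \<phi>'_def by (intro continuous_intros that)+
  have \<rho>t: "torus_smooth (\<rho> t)" if "t \<in> J" for t
    using \<rho> spacetime_smooth_slice that by (auto simp: torus_smooth_def)
  have cr: "continuous_on UNIV (\<rho> t)" if "t \<in> J" for t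
    by (rule torus_smooth_continuous[OF \<rho>t[OF that]])
  have "torus_integral (\<lambda>x. \<phi> (\<rho> 0 x)) = torus_integral (\<lambda>x. \<phi> (\<rho> t x))"
  proof (rule torus_integral_conserved[where g' = "\<lambda>t x. \<phi>' (\<rho> t x) * time_deriv J \<rho> t x"])
    show "is_interval J" "0 \<in> J" using J by (auto simp: time_interval_def)
    show "((\<lambda>t. \<phi> (\<rho> t x)) has_vector_derivative \<phi>' (\<rho> t x) * time_deriv J \<rho> t x) (at t within J)"
      if "t \<in> J" for t x
      using has_derivative_compose[OF has_time_deriv[OF J \<rho>(1) that, unfolded has_vector_derivative_def] d\<phi>]
      by (simp add: has_vector_derivative_def mult_ac)
    have "continuous_on (J \<times> UNIV) (\<lambda>z. \<phi>' ((\<lambda>(t, x). \<rho> t x) z) * (\<lambda>(t, x). time_deriv J \<rho> t x) z)"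
      by (intro continuous_on_mult c\<phi> smooth_on_continuous \<rho>(1) spacetime_smooth_time_deriv J)
    then show "continuous_on (J \<times> UNIV) (\<lambda>(t, x). \<phi>' (\<rho> t x) * time_deriv J \<rho> t x)"
      by (simp add: case_prod_beta')
    show "continuous_on UNIV (\<lambda>x. \<phi> (\<rho> t x))" if "t \<in> J" for t
      by (intro c\<phi> cr that)
    show "torus_integral (\<lambda>x. \<phi>' (\<rho> t x) * time_deriv J \<rho> t x) = 0" if t: "t \<in> J" for t
    proof -
      \<comment> \<open>\<open>?P j\<close> is the j-th partial derivative of u_j \<phi>(\<rho>),
        written out by the product and chain rules.\<close>
      let ?P = "\<lambda>j x. u t x $ j * (\<phi>' (\<rho> t x) * partial_deriv j (\<rho> t) x)
          + partial_deriv j (\<lambda>x. u t x $ j) x * \<phi> (\<rho> t x)"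
      have cu: "continuous_on UNIV (\<lambda>x. u t x $ j)" "continuous_on UNIV (partial_deriv j (\<lambda>x. u t x $ j))"
        "continuous_on UNIV (partial_deriv j (\<rho> t))" for j
        using u[OF t] \<rho>t[OF t] by (auto intro!: torus_smooth_continuous torus_smooth_partial_deriv)
      have cP: "continuous_on UNIV (?P j)" for j
        by (intro continuous_intros c\<phi> cu cr t)
      have P: "torus_integral (?P j) = 0" for j
      proof -
        let ?D = "\<lambda>x v. u t x $ j * (\<phi>' (\<rho> t x) * (v \<bullet> grad (\<rho> t) x))
            + (v \<bullet> grad (\<lambda>x. u t x $ j) x) * \<phi> (\<rho> t x)"
        have D: "?D x (axis j 1) = ?P j x" for x
          by (simp add: inner_axis' grad_def)
        \<comment> \<open>Here \<phi>(\<rho>) is obtained only as a C^1 function, so the version for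
          continuous derivatives is the one to use.\<close>
        have "torus_integral (\<lambda>x. ?D x (axis j 1)) = 0"
        proof (rule torus_integral_derivative)
          show "periodic (\<lambda>x. u t x $ j * \<phi> (\<rho> t x))"
            using u[OF t] \<rho>t[OF t] by (simp add: torus_smooth_def periodic_def)
          show "((\<lambda>x. u t x $ j * \<phi> (\<rho> t x)) has_derivative ?D x) (at x)" for x
            by (intro has_derivative_mult has_derivative_grad
                has_derivative_compose[OF has_derivative_grad d\<phi>] torus_smooth_differentiable u \<rho>t t)
          show "continuous_on UNIV (\<lambda>x. ?D x (axis j 1))"
            unfolding D by (rule cP)
        qed
        then show ?thesis unfolding D .
      qed
      \<comment> \<open>The terms of \<open>?P\<close> that contain \<phi> itself add up to (div u)
        \<phi>(\<rho>) = 0; the others form \<phi>'(\<rho>) times u . grad \<rho>, which transport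
        equates with minus the left-hand side.\<close>
      have "\<phi>' (\<rho> t x) * time_deriv J \<rho> t x = - (?P 1 x + ?P 2 x)" for x
      proof -
        have 1: "time_deriv J \<rho> t x
            = - (u t x $ 1 * partial_deriv 1 (\<rho> t) x + u t x $ 2 * partial_deriv 2 (\<rho> t) x)"
          using transport[OF t, of x] by (simp add: inner_vec_def sum_2 grad_def)
        have 2: "partial_deriv 1 (\<lambda>x. u t x $ 1) x = - partial_deriv 2 (\<lambda>x. u t x $ 2) x"
          using div[OF t, of x] by (simp add: divergence_def sum_2)
        show ?thesis unfolding 1 2 by (simp add: algebra_simps)
      qed
      then have "torus_integral (\<lambda>x. \<phi>' (\<rho> t x) * time_deriv J \<rho> t x)
          = - (torus_integral (?P 1) + torus_integral (?P 2))"
        using torus_integral_bounded_linear[OF bounded_linear_minus[OF bounded_linear_ident]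
            continuous_on_add[OF cP[of 1] cP[of 2]]] torus_integral_add[OF cP[of 1] cP[of 2]]
        by (simp only:)
      then show ?thesis by (simp only: P)
    qed
  qed (rule t)
  moreover have "\<phi> (\<rho> 0 x) = 0" for x
    using init[of x] by (simp add: \<phi>_def)
  ultimately have "torus_integral (\<lambda>x. \<phi> (\<rho> t x)) = 0" by simp
  then have "\<phi> (\<rho> t x) = 0"
    using \<rho>(2)[OF t] c\<phi>(1)[OF cr[OF t]]
    by (intro torus_integral_nonneg_eq_0[where f = "\<lambda>x. \<phi> (\<rho> t x)"]) (auto simp: periodic_def \<phi>_def)
  then show ?thesis by (auto simp: \<phi>_def max_def split: if_splits)
qed

section \<open>The vorticity equation\<close>

text \<open>With div u = 0 the convective term is u . grad M and u . grad N for the momentum (M, N)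
  = (R U, R V). Its curl is u . grad \<omega> plus (d_1 u) . grad N - (d_2 u) . grad M. In the
  latter the terms with undifferentiated R carry the factor div u and vanish, and those with
  derivatives of R form the bracket.\<close>

lemma curl_convection:
  fixes R U V :: "real^2 \<Rightarrow> real"
  assumes R: "smooth_on UNIV R" and U: "smooth_on UNIV U" and V: "smooth_on UNIV V"
    and div: "\<And>x. partial_deriv 1 U x + partial_deriv 2 V x = 0"
  defines "\<omega> \<equiv> \<lambda>x. partial_deriv 1 (\<lambda>y. R y * V y) x - partial_deriv 2 (\<lambda>y. R y * U y) x"
  shows "partial_deriv 1 (\<lambda>y. partial_deriv 1 (\<lambda>z. R z * (V z * U z)) y
          + partial_deriv 2 (\<lambda>z. R z * (V z * V z)) y) x
      - partial_deriv 2 (\<lambda>y. partial_deriv 1 (\<lambda>z. R z * (U z * U z)) y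
          + partial_deriv 2 (\<lambda>z. R z * (U z * V z)) y) x
    = U x * partial_deriv 1 \<omega> x + V x * partial_deriv 2 \<omega> x
      + poisson_bracket (\<lambda>y. ((U y)\<^sup>2 + (V y)\<^sup>2) / 2) R x"
proof -
  note sd = smooth_differentiable
  note sm = smooth_on_mult[OF thick_UNIV] smooth_partial_deriv
  define M where "M = (\<lambda>y. R y * U y)"
  define N where "N = (\<lambda>y. R y * V y)"
  have M: "smooth_on UNIV M" and N: "smooth_on UNIV N"
    unfolding M_def N_def by (intro sm R U V)+
  have div': "partial_deriv 2 V y = - partial_deriv 1 U y" for y
    using div[of y] by simp
  have conv: "partial_deriv 1 (\<lambda>z. R z * (W z * U z)) y + partial_deriv 2 (\<lambda>z. R z * (W z * V z)) y
      = U y * partial_deriv 1 (\<lambda>z. R z * W z) y + V y * partial_deriv 2 (\<lambda>z. R z * W z) y"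
    if W: "smooth_on UNIV W" for W y
  proof -
    have RW: "smooth_on UNIV (\<lambda>z. R z * W z)" by (intro sm R W)
    have "partial_deriv 1 (\<lambda>z. R z * W z * U z) y + partial_deriv 2 (\<lambda>z. R z * W z * V z) y
        = U y * partial_deriv 1 (\<lambda>z. R z * W z) y + V y * partial_deriv 2 (\<lambda>z. R z * W z) y"
      unfolding partial_deriv_mult[OF sd[OF RW] sd[OF U]] partial_deriv_mult[OF sd[OF RW] sd[OF V]] div'
      by (simp add: algebra_simps)
    then show ?thesis by (simp add: mult.assoc)
  qed
  have conv': "partial_deriv i (\<lambda>y. U y * partial_deriv 1 W y + V y * partial_deriv 2 W y) x
      = U x * partial_deriv i (partial_deriv 1 W) x + partial_deriv i U x * partial_deriv 1 W x
      + (V x * partial_deriv i (partial_deriv 2 W) x + partial_deriv i V x * partial_deriv 2 W x)"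
    if W: "smooth_on UNIV W" for W i
    by (subst partial_deriv_add, (intro sd sm U V W)+)
       (simp add: partial_deriv_mult[OF sd[OF U] sd[OF smooth_partial_deriv[OF W]]]
          partial_deriv_mult[OF sd[OF V] sd[OF smooth_partial_deriv[OF W]]])
  have \<omega>: "partial_deriv i \<omega> x
      = partial_deriv i (partial_deriv 1 N) x - partial_deriv i (partial_deriv 2 M) x" for i
    unfolding \<omega>_def M_def[symmetric] N_def[symmetric]
    by (intro partial_deriv_diff sd sm M N)
  have dM: "partial_deriv i M x = R x * partial_deriv i U x + partial_deriv i R x * U x"
    and dN: "partial_deriv i N x = R x * partial_deriv i V x + partial_deriv i R x * V x" for i
    unfolding M_def N_def by (intro partial_deriv_mult sd R U V)+
  have sq: "partial_deriv i (\<lambda>y. ((U y)\<^sup>2 + (V y)\<^sup>2) / 2) x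
      = U x * partial_deriv i U x + V x * partial_deriv i V x" for i
  proof -
    have UU: "smooth_on UNIV (\<lambda>y. U y * U y)" "smooth_on UNIV (\<lambda>y. V y * V y)"
      by (intro sm U V)+
    have "partial_deriv i (\<lambda>y. (1/2) * (U y * U y + V y * V y)) x
        = (1/2) * partial_deriv i (\<lambda>y. U y * U y + V y * V y) x"
      by (subst partial_deriv_mult[OF sd sd[OF smooth_on_add[OF thick_UNIV UU]]])
         (auto intro: smooth_on_const)
    also have "partial_deriv i (\<lambda>y. U y * U y + V y * V y) x
        = 2 * (U x * partial_deriv i U x) + 2 * (V x * partial_deriv i V x)"
      by (simp add: partial_deriv_add[OF sd[OF UU(1)] sd[OF UU(2)]]
            partial_deriv_mult[OF sd[OF U] sd[OF U]] partial_deriv_mult[OF sd[OF V] sd[OF V]])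
    also have "(1/2) * (2 * (U x * partial_deriv i U x) + 2 * (V x * partial_deriv i V x))
        = U x * partial_deriv i U x + V x * partial_deriv i V x"
      by simp
    finally show ?thesis by (simp add: power2_eq_square)
  qed
  have comm: "partial_deriv 2 (partial_deriv 1 M) x = partial_deriv 1 (partial_deriv 2 M) x"
    "partial_deriv 2 (partial_deriv 1 N) x = partial_deriv 1 (partial_deriv 2 N) x"
    by (rule partial_deriv_commute[OF M], rule partial_deriv_commute[OF N])
  show ?thesis
    unfolding conv[OF V] conv[OF U] M_def[symmetric] N_def[symmetric] conv'[OF M] conv'[OF N]
      \<omega> comm poisson_bracket_def sq
    \<comment> \<open>Second derivatives of M and N now occur alike on both sides, so expanding the
      first derivatives is enough.\<close>
    unfolding dM dN div' by (simp add: algebra_simps)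
qed

section \<open>The stream-vorticity formulation\<close>

lemma spacetime_smooth_component:
  fixes u :: "real \<Rightarrow> real^2 \<Rightarrow> real^2"
  assumes "time_interval J" "spacetime_smooth J u"
  shows "spacetime_smooth J (\<lambda>t x. u t x $ i)"
  using smooth_on_bounded_linear[OF thick_spacetime[OF assms(1)] bounded_linear_vec_nth[of i] assms(2)]
  by (simp add: case_prod_beta')

lemma spacetime_smooth_mult:
  fixes f g :: "real \<Rightarrow> real^2 \<Rightarrow> real"
  assumes "time_interval J" "spacetime_smooth J f" "spacetime_smooth J g"
  shows "spacetime_smooth J (\<lambda>t x. f t x * g t x)"
  using smooth_on_mult[OF thick_spacetime[OF assms(1)] assms(2,3)] by (simp add: case_prod_beta')

lemma torus_smooth_time_slice: "torus_smooth_time J f \<Longrightarrow> t \<in> J \<Longrightarrow> torus_smooth (f t)"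
  by (auto simp: torus_smooth_time_def torus_smooth_def intro: spacetime_smooth_slice)

lemma momentum_equation:
  assumes J: "time_interval J" and u: "spacetime_smooth J u" and \<rho>: "spacetime_smooth J \<rho>"
    and euler: "inhomogeneous_euler J u \<rho> p" and t: "t \<in> J"
  shows "time_deriv J (\<lambda>t x. \<rho> t x * u t x $ i) t x
    = - (partial_deriv 1 (\<lambda>y. \<rho> t y * (u t y $ i * u t y $ 1)) x
        + partial_deriv 2 (\<lambda>y. \<rho> t y * (u t y $ i * u t y $ 2)) x)
      - partial_deriv i (p t) x"
proof -
  let ?D = "\<rho> t x *\<^sub>R time_deriv J u t x + time_deriv J \<rho> t x *\<^sub>R u t x"
  have D: "((\<lambda>s. \<rho> s x *\<^sub>R u s x) has_vector_derivative ?D) (at t within J)"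
    by (rule bounded_bilinear.has_vector_derivative[OF bounded_bilinear_scaleR
          has_time_deriv[OF J \<rho> t] has_time_deriv[OF J u t]])
  have "((\<lambda>s. \<rho> s x * u s x $ i) has_vector_derivative ?D $ i) (at t within J)"
    using bounded_linear.has_vector_derivative[OF bounded_linear_vec_nth[of i] D] by simp
  then have "time_deriv J (\<lambda>t x. \<rho> t x * u t x $ i) t x = ?D $ i"
    by (rule time_derivI[OF J t])
  moreover have "time_deriv J (\<lambda>t x. \<rho> t x *\<^sub>R u t x) t x = ?D"
    by (rule time_derivI[where f = "\<lambda>t x. \<rho> t x *\<^sub>R u t x" and x = x, OF J t D])
  moreover have "time_deriv J (\<lambda>t x. \<rho> t x *\<^sub>R u t x) t x $ i
      + tensor_divergence (\<lambda>y. \<rho> t y *\<^sub>R outer (u t y) (u t y)) x $ i + grad (p t) x $ i = 0"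
  proof -
    have "time_deriv J (\<lambda>t x. \<rho> t x *\<^sub>R u t x) t x
        + tensor_divergence (\<lambda>y. \<rho> t y *\<^sub>R outer (u t y) (u t y)) x + grad (p t) x = 0"
      using euler t unfolding inhomogeneous_euler_def by blast
    from arg_cong[OF this, of "\<lambda>v. v $ i"] show ?thesis
      unfolding vector_add_component zero_index .
  qed
  ultimately show ?thesis
    by (simp add: tensor_divergence_def grad_def outer_def sum_2)
qed

text \<open>The time derivative of each momentum component is a sum of spatial derivatives of
  periodic functions. Periodicity of the pressure enters here: its gradient integrates to
  zero.\<close>

lemma momentum_conserved:
  assumes J: "time_interval J" and u: "torus_smooth_time J u" and \<rho>: "torus_smooth_time J \<rho>"
    and p: "torus_smooth_time J p" and euler: "inhomogeneous_euler J u \<rho> p" and t: "t \<in> J"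
  shows "torus_integral (\<lambda>x. \<rho> t x * u t x $ i) = torus_integral (\<lambda>x. \<rho> 0 x * u 0 x $ i)"
proof (rule torus_integral_conserved[where g' = "time_deriv J (\<lambda>t x. \<rho> t x * u t x $ i)"])
  have su: "spacetime_smooth J u" and s\<rho>: "spacetime_smooth J \<rho>"
    using u \<rho> by (auto simp: torus_smooth_time_def)
  have m: "spacetime_smooth J (\<lambda>t x. \<rho> t x * u t x $ i)"
    by (intro spacetime_smooth_mult spacetime_smooth_component J su s\<rho>)
  show "is_interval J" "0 \<in> J" using J by (auto simp: time_interval_def)
  show "((\<lambda>t. \<rho> t x * u t x $ i) has_vector_derivative
      time_deriv J (\<lambda>t x. \<rho> t x * u t x $ i) t x) (at t within J)" if "t \<in> J" for t x
    by (rule has_time_deriv[OF J m that])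
  show "continuous_on (J \<times> UNIV) (\<lambda>(t, x). time_deriv J (\<lambda>t x. \<rho> t x * u t x $ i) t x)"
    by (rule smooth_on_continuous[OF spacetime_smooth_time_deriv[OF J m]])
  show "continuous_on UNIV (\<lambda>x. \<rho> t x * u t x $ i)" if "t \<in> J" for t
    by (rule smooth_on_continuous[OF spacetime_smooth_slice[OF m that]])
  show "torus_integral (time_deriv J (\<lambda>t x. \<rho> t x * u t x $ i) t) = 0" if t: "t \<in> J" for t
  proof -
    let ?F = "\<lambda>j y. \<rho> t y * (u t y $ i * u t y $ j)"
    have F: "torus_smooth (?F j)" for j
      using torus_smooth_time_slice[OF u t] torus_smooth_time_slice[OF \<rho> t]
      by (intro torus_smooth_mult torus_smooth_bounded_linear[OF bounded_linear_vec_nth])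
    note P = torus_smooth_time_slice[OF p t]
    have cF: "continuous_on UNIV (partial_deriv j (?F j))" for j
      by (intro torus_smooth_continuous torus_smooth_partial_deriv F)
    have cP: "continuous_on UNIV (partial_deriv i (p t))"
      by (intro torus_smooth_continuous torus_smooth_partial_deriv P)
    let ?S = "\<lambda>x. partial_deriv 1 (?F 1) x + partial_deriv 2 (?F 2) x + partial_deriv i (p t) x"
    have "torus_integral ?S = torus_integral (partial_deriv 1 (?F 1))
        + torus_integral (partial_deriv 2 (?F 2)) + torus_integral (partial_deriv i (p t))"
      by (simp only: torus_integral_add[OF continuous_on_add[OF cF cF] cP] torus_integral_add[OF cF cF])
    then have S: "torus_integral ?S = 0"
      by (simp only: torus_integral_partial_deriv[OF F] torus_integral_partial_deriv[OF P] add_0_right)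
    have "time_deriv J (\<lambda>t x. \<rho> t x * u t x $ i) t = (\<lambda>x. - ?S x)"
      by (simp add: fun_eq_iff momentum_equation[OF J su s\<rho> euler t])
    moreover have "torus_integral (\<lambda>x. - ?S x) = - torus_integral ?S"
      by (rule torus_integral_bounded_linear[OF bounded_linear_minus[OF bounded_linear_ident]])
         (intro continuous_on_add cF cP)
    ultimately show ?thesis using S by simp
  qed
qed (rule t)

lemma vorticity_equation:
  assumes J: "time_interval J" and u: "spacetime_smooth J u" and \<rho>: "spacetime_smooth J \<rho>"
    and p: "spacetime_smooth J p" and euler: "inhomogeneous_euler J u \<rho> p" and t: "t \<in> J"
  defines "\<omega> \<equiv> \<lambda>t. curl (\<lambda>x. \<rho> t x *\<^sub>R u t x)"
  shows "time_deriv J \<omega> t x + u t x \<bullet> grad (\<omega> t) x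
    + poisson_bracket (\<lambda>y. (norm (u t y))\<^sup>2 / 2) (\<rho> t) x = 0"
proof -
  let ?m = "\<lambda>i t x. \<rho> t x * u t x $ i"
  let ?C = "\<lambda>i y. partial_deriv 1 (\<lambda>y. \<rho> t y * (u t y $ i * u t y $ 1)) y
        + partial_deriv 2 (\<lambda>y. \<rho> t y * (u t y $ i * u t y $ 2)) y"
  have m: "spacetime_smooth J (?m i)" for i
    by (intro spacetime_smooth_mult spacetime_smooth_component J u \<rho>)
  have ut: "smooth_on UNIV (\<lambda>y. u t y $ i)" for i
    using spacetime_smooth_slice[OF spacetime_smooth_component[OF J u] t] .
  note \<rho>t = spacetime_smooth_slice[OF \<rho> t] and pt = spacetime_smooth_slice[OF p t]
  have C: "smooth_on UNIV (?C i)" for i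
    by (intro smooth_on_add smooth_partial_deriv smooth_on_mult thick_UNIV ut \<rho>t)
  have \<omega>: "\<omega> = (\<lambda>t x. partial_deriv 1 (?m 2 t) x - partial_deriv 2 (?m 1 t) x)"
    by (simp add: \<omega>_def curl_def fun_eq_iff)
  have dm: "time_deriv J (?m i) t = (\<lambda>y. - ?C i y - partial_deriv i (p t) y)" for i
    by (rule ext) (rule momentum_equation[OF J u \<rho> euler t])
  \<comment> \<open>The momentum equation may be differentiated in space because it holds at every
    point of the slice at time t.\<close>
  have ddm: "partial_deriv j (time_deriv J (?m i) t) x
      = - partial_deriv j (?C i) x - partial_deriv j (partial_deriv i (p t)) x" for i j
  proof -
    have "partial_deriv j (time_deriv J (?m i) t) x
        = partial_deriv j (\<lambda>y. - ?C i y) x - partial_deriv j (partial_deriv i (p t)) x"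
      unfolding dm
      by (intro partial_deriv_diff smooth_differentiable smooth_on_minus thick_UNIV C smooth_partial_deriv pt)
    also have "partial_deriv j (\<lambda>y. - ?C i y) x = - partial_deriv j (?C i) x"
      by (rule partial_deriv_minus[OF smooth_differentiable[OF C]])
    finally show ?thesis .
  qed
  have "((\<lambda>s. \<omega> s x) has_vector_derivative
      time_deriv J (\<lambda>t. partial_deriv 1 (?m 2 t)) t x - time_deriv J (\<lambda>t. partial_deriv 2 (?m 1 t)) t x)
      (at t within J)"
    unfolding \<omega>
    by (intro has_vector_derivative_diff has_time_deriv[OF J spacetime_smooth_partial_deriv[OF m] t])
  then have "time_deriv J \<omega> t x
      = time_deriv J (\<lambda>t. partial_deriv 1 (?m 2 t)) t x - time_deriv J (\<lambda>t. partial_deriv 2 (?m 1 t)) t x"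
    by (rule time_derivI[OF J t])
  also have "\<dots> = partial_deriv 1 (time_deriv J (?m 2) t) x - partial_deriv 2 (time_deriv J (?m 1) t) x"
    by (simp only: time_deriv_partial_deriv[OF J m t])
  also have "\<dots> = - (partial_deriv 1 (?C 2) x - partial_deriv 2 (?C 1) x)"
    unfolding ddm by (simp add: partial_deriv_commute[OF pt, of 2 1])
  finally have dt: "time_deriv J \<omega> t x = - (partial_deriv 1 (?C 2) x - partial_deriv 2 (?C 1) x)" .
  have conv: "partial_deriv 1 (?C 2) x - partial_deriv 2 (?C 1) x
      = u t x $ 1 * partial_deriv 1 (\<omega> t) x + u t x $ 2 * partial_deriv 2 (\<omega> t) x
        + poisson_bracket (\<lambda>y. ((u t y $ 1)\<^sup>2 + (u t y $ 2)\<^sup>2) / 2) (\<rho> t) x"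
    unfolding \<omega>
  proof (rule curl_convection[OF \<rho>t ut ut])
    show "partial_deriv 1 (\<lambda>y. u t y $ 1) x + partial_deriv 2 (\<lambda>y. u t y $ 2) x = 0" for x
      using euler t by (simp add: inhomogeneous_euler_def divergence_def sum_2)
  qed
  have "(norm (u t y))\<^sup>2 = (u t y $ 1)\<^sup>2 + (u t y $ 2)\<^sup>2" for y
    unfolding power2_norm_eq_inner by (simp add: inner_vec_def sum_2 power2_eq_square)
  moreover have "u t x \<bullet> grad (\<omega> t) x
      = u t x $ 1 * partial_deriv 1 (\<omega> t) x + u t x $ 2 * partial_deriv 2 (\<omega> t) x"
    by (simp add: inner_vec_def sum_2 grad_def)
  ultimately show ?thesis
    using dt unfolding conv by simp
qed

theorem mainTheorem4:
  fixes \<rho>0 :: "real^2 \<Rightarrow> real" and u0 :: "real^2 \<Rightarrow> real^2" and C1 :: real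
    and I :: "real set"
    and u :: "real \<Rightarrow> real^2 \<Rightarrow> real^2" and \<rho> p :: "real \<Rightarrow> real^2 \<Rightarrow> real"
    and \<omega> :: "real \<Rightarrow> real^2 \<Rightarrow> real"
  assumes "torus_smooth \<rho>0" and "torus_integral \<rho>0 = 1"
    and "C1 > 1" and "\<forall>x. inverse C1 \<le> \<rho>0 x \<and> \<rho>0 x \<le> C1"
    and "torus_smooth u0" and "\<forall>x. divergence u0 x = 0"
    and "torus_integral (\<lambda>x. \<rho>0 x *\<^sub>R u0 x) = 0"
    and "is_interval I" and "0 \<in> I" and "I \<noteq> {0}"
    and "torus_smooth_time I u" and "torus_smooth_time I \<rho>" and "torus_smooth_time I p"
    and "inhomogeneous_euler I u \<rho> p"
    and "u 0 = u0" and "\<rho> 0 = \<rho>0"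
  defines "\<omega> \<equiv> \<lambda>t. curl (\<lambda>x. \<rho> t x *\<^sub>R u t x)"
  shows "\<forall>t\<in>I. \<forall>x.
      time_deriv I \<omega> t x + u t x \<bullet> grad (\<omega> t) x
        + poisson_bracket (\<lambda>y. (norm (u t y))\<^sup>2 / 2) (\<rho> t) x = 0
    \<and> u t x = weighted_leray (\<rho> t)
        (\<lambda>y. inverse (\<rho> t y) *\<^sub>R perp_grad (inv_laplacian (\<omega> t)) y) x
    \<and> time_deriv I \<rho> t x + u t x \<bullet> grad (\<rho> t) x = 0"
proof (intro ballI allI conjI)
  fix t x assume t: "t \<in> I"
  note u = assms(11) and \<rho> = assms(12) and p = assms(13) and euler = assms(14)
  have J: "time_interval I"
    using assms(8-10) by (simp add: time_interval_def)
  have s: "spacetime_smooth I u" "spacetime_smooth I \<rho>" "spacetime_smooth I p"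
    using u \<rho> p by (auto simp: torus_smooth_time_def)
  have ut: "torus_smooth (\<lambda>x. u t x $ i)" if "t \<in> I" for t i
    by (rule torus_smooth_bounded_linear[OF bounded_linear_vec_nth torus_smooth_time_slice[OF u that]])
  have div: "divergence (u t) x = 0"
    and transport: "time_deriv I \<rho> t x + u t x \<bullet> grad (\<rho> t) x = 0" if "t \<in> I" for t x
    using euler that by (auto simp: inhomogeneous_euler_def)
  show "time_deriv I \<rho> t x + u t x \<bullet> grad (\<rho> t) x = 0"
    by (rule transport[OF t])
  show "time_deriv I \<omega> t x + u t x \<bullet> grad (\<omega> t) x
      + poisson_bracket (\<lambda>y. (norm (u t y))\<^sup>2 / 2) (\<rho> t) x = 0"
    unfolding \<omega>_def by (rule vorticity_equation[OF J s euler t])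
  \<comment> \<open>The bound is given at time 0; transport carries it to time t, where the weighted
    operators need a positive density.\<close>
  have "inverse C1 \<le> \<rho> t y" for y
  proof (rule transport_lower_bound[OF J t s(2) _ ut div transport])
    show "periodic (\<rho> t)" if "t \<in> I" for t
      using \<rho> that by (simp add: torus_smooth_time_def)
    show "inverse C1 \<le> \<rho> 0 y" for y
      using assms(4,16) by simp
  qed
  then have pos: "\<rho> t y > 0" for y
    using assms(3) by (meson less_le_trans positive_imp_inverse_positive less_trans zero_less_one)
  \<comment> \<open>The initial condition is on a vector-valued integral, whereas conservation is
    componentwise; taking a component commutes with the integral.\<close>
  have mean: "torus_integral (\<lambda>x. \<rho> t x * u t x $ i) = 0" for i
  proof -
    have "continuous_on UNIV (\<lambda>x. \<rho>0 x *\<^sub>R u0 x)"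
      using assms(1,5) by (intro continuous_on_scaleR torus_smooth_continuous)
    then have "torus_integral (\<lambda>x. (\<rho>0 x *\<^sub>R u0 x) $ i) = 0"
      using assms(7) by (subst torus_integral_bounded_linear[OF bounded_linear_vec_nth]) simp_all
    then show ?thesis
      using momentum_conserved[OF J u \<rho> p euler t, of i] assms(15,16) by simp
  qed
  show "u t x = weighted_leray (\<rho> t)
      (\<lambda>y. inverse (\<rho> t y) *\<^sub>R perp_grad (inv_laplacian (\<omega> t)) y) x"
    unfolding \<omega>_def
    by (rule weighted_leray_stream_function[OF torus_smooth_time_slice[OF \<rho> t] pos ut[OF t] div[OF t] mean])
qed

end
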